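(* Let $\alpha_1,\alpha_3,\alpha_4\in\mathbb{F}_{p^m}^*$ be such that $\alpha=\alpha_1+\alpha_3v+\alpha_4uv$ is not a cube in $\mathcal{R}$. Let $\mathcal{C}=\langle(x^3-\alpha_0)^\ell+u(x^3-\alpha_0)^tz(x),\,u(x^3-\alpha_0)^\mu\rangle\subseteq\frac{\mathcal{R}[x]}{\langle x^{3p^s}-\alpha\rangle}$, where $0\le\ell\le2p^s-1$, $0\le t<\ell$, $z(x)$ is $0$ or invertible, and $0\le\mu<\Im$ with $\Im=\ell$ if $z(x)=0$ and $\Im=\min\{\ell,2p^s+t-\ell\}$ if $z(x)\ne0$. If $z(x)$ is invertible, write $z(x)=\sum_{\kappa=0}^{\mu-t-1}(z_{0\kappa}x^2+z_{1\kappa}x+z_{2\kappa})(x^3-\alpha_0)^\kappa$ with $z_{0\kappa},z_{1\kappa},z_{2\kappa}\in\mathbb{F}_{p^m}$ and $z_{00}x^2+z_{10}x+z_{20}\ne0$. Then the dual code $\mathcal{C}^\perp$, associated to the ideal $\mathcal{A}(\mathcal{C})^*$ of $\frac{\mathcal{R}[x]}{\langle x^{3p^s}-\alpha^{-1}\rangle}$, is determined as follows. 1. If $z(x)=0$, then $\mathcal{A}(\mathcal{C})^*=\langle\varphi_1^*(x),\,u(x^3-\alpha_0^{-1})^{2p^s-\ell}\rangle$, where $\varphi_1^*(x)=(-\alpha_0)^{2p^s-\mu}(x^3-\alpha_0^{-1})^{2p^s-\mu}$. 2. If $z(x)$ is invertible, then $\mathcal{A}(\mathcal{C})^*=\langle\varphi_2^*(x),\,u(x^3-\alpha_0^{-1})^{2p^s-\ell}\rangle$,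 where $$\varphi_2^*(x)=(-\alpha_0)^{2p^s-\mu}(x^3-\alpha_0^{-1})^{2p^s-\mu}-u(-\alpha_0)^{2p^s+t-\ell-\mu}(x^3-\alpha_0^{-1})^{2p^s+t-\ell-\mu}\sum_{\kappa=0}^{\mu-t-1}(z_{2\kappa}x^2+z_{1\kappa}x+z_{0\kappa})(-\alpha_0)^\kappa(x^3-\alpha_0^{-1})^\kappa x^{3\ell-3t-3\kappa-2}.$$
   Context: $p\neq3$ is a prime, $m,s$ are positive integers, and $\mathcal{R}=\frac{\mathbb{F}_{p^m}[u,v]}{\langle u^2,v^2,uv-vu\rangle}=\mathbb{F}_{p^m}+u\mathbb{F}_{p^m}+v\mathbb{F}_{p^m}+uv\mathbb{F}_{p^m}$ with $u^2=v^2=0$, $uv=vu$. Writing $s=q_0m+r_0$ with $q_0\ge0$ and $0\le r_0\le m-1$, put $\alpha_0=\alpha_1^{p^{m-r_0}}$, so that $\alpha_0^{p^s}=\alpha_1$. Constacyclic codes of length $n=3p^s$ are identified with ideals via $(c_0,\dots,c_{n-1})\mapsto\sum c_ix^i$; $\mathcal{C}^\perp$ is the dual for the standard inner product on $\mathcal{R}^n$. For an ideal $\mathcal{C}$ of $\frac{\mathcal{R}[x]}{\langle x^{3p^s}-\alpha\rangle}$, $\mathcal{A}(\mathcal{C})$ is its annihilator; the reciprocal of a polynomial $f$ of degree $k$ is $f^*(x)=x^kf(x^{-1})$ ($0^*=0$), and $\mathcal{A}(\mathcal{C})^*=\{f^*(x): f(x)\in\mathcal{R}[x]\text{ represents an element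 of }\mathcal{A}(\mathcal{C})\}$, viewed in $\frac{\mathcal{R}[x]}{\langle x^{3p^s}-\alpha^{-1}\rangle}$. One has $\mathcal{C}^\perp=\mathcal{A}(\mathcal{C})^*$. *)

theory Defs
  imports
    "HOL-Algebra.Algebraic_Closure_Type"
    "HOL-Computational_Algebra.Polynomial"
    "HOL-Library.Cardinality"
begin

text \<open>
  The ring \<open>F[u,v]/\<langle>u\<^sup>2, v\<^sup>2, uv - vu\<rangle> = F + uF + vF + uvF\<close>, on the basis \<open>1, u, v, uv\<close>:
  \<open>Ruv a b c d\<close> stands for \<open>a + b u + c v + d uv\<close>.
\<close>

datatype 'a ruv = Ruv (coeff_1: 'a) (coeff_u: 'a) (coeff_v: 'a) (coeff_uv: 'a)

instantiation ruv :: (comm_ring_1) comm_ring_1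
begin

definition "0 = Ruv 0 0 0 0"

definition "1 = Ruv 1 0 0 0"

definition "x + y =
  Ruv (coeff_1 x + coeff_1 y) (coeff_u x + coeff_u y) (coeff_v x + coeff_v y) (coeff_uv x + coeff_uv y)"

definition "- x = Ruv (- coeff_1 x) (- coeff_u x) (- coeff_v x) (- coeff_uv x)"

definition "x - y =
  Ruv (coeff_1 x - coeff_1 y) (coeff_u x - coeff_u y) (coeff_v x - coeff_v y) (coeff_uv x - coeff_uv y)"

definition "x * y =
  Ruv (coeff_1 x * coeff_1 y)
      (coeff_1 x * coeff_u y + coeff_u x * coeff_1 y)
      (coeff_1 x * coeff_v y + coeff_v x * coeff_1 y)
      (coeff_1 x * coeff_uv y + coeff_u x * coeff_v y + coeff_v x * coeff_u y + coeff_uv x * coeff_1 y)"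

instance
  by standard
    (auto simp: zero_ruv_def one_ruv_def plus_ruv_def uminus_ruv_def minus_ruv_def times_ruv_def
      algebra_simps)

end

definition emb :: "'a::comm_ring_1 \<Rightarrow> 'a ruv" where
  "emb a = Ruv a 0 0 0"

definition ru :: "'a::comm_ring_1 ruv" where
  "ru = Ruv 0 1 0 0"

definition rv :: "'a::comm_ring_1 ruv" where
  "rv = Ruv 0 0 1 0"

lemma ruv_relations: "ru * ru = 0" "rv * rv = 0" "ru * rv = rv * ru"
  by (simp_all add: ru_def rv_def times_ruv_def zero_ruv_def)

lemma Ruv_eq: "Ruv a b c d = emb a + emb b * ru + emb c * rv + emb d * (ru * rv)"
  by (simp add: emb_def ru_def rv_def times_ruv_def plus_ruv_def)

lemma emb_hom:
  "emb 0 = 0" "emb 1 = 1" "emb (a + b) = emb a + emb b" "emb (a * b) = emb a * emb b"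
  by (simp_all add: emb_def zero_ruv_def one_ruv_def plus_ruv_def times_ruv_def)

text \<open>
  \<open>R[x]/\<langle>x\<^sup>n - a\<rangle>\<close>, as a factor ring of the type-class polynomial ring; its elements are cosets,
  and \<open>cc_class n a f\<close> is the coset of \<open>f\<close>.
\<close>

definition cc_ideal :: "nat \<Rightarrow> 'r::comm_ring_1 \<Rightarrow> 'r poly set" where
  "cc_ideal n a = genideal ring_of_type_algebra {Polynomial.monom 1 n - [:a:]}"

definition cc_ring :: "nat \<Rightarrow> 'r::comm_ring_1 \<Rightarrow> 'r poly set ring" where
  "cc_ring n a = FactRing ring_of_type_algebra (cc_ideal n a)"

definition cc_class :: "nat \<Rightarrow> 'r::comm_ring_1 \<Rightarrow> 'r poly \<Rightarrow> 'r poly set" where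
  "cc_class n a f = a_r_coset ring_of_type_algebra (cc_ideal n a) f"

definition annihilator :: "('c, 'd) ring_scheme \<Rightarrow> 'c set \<Rightarrow> 'c set" where
  "annihilator Q J = {y \<in> carrier Q. \<forall>c\<in>J. y \<otimes>\<^bsub>Q\<^esub> c = \<zero>\<^bsub>Q\<^esub>}"

text \<open>
  \<open>{f\<^sup>* : f represents an element of J}\<close>, where \<open>J\<close> lives in \<open>R[x]/\<langle>x\<^sup>n - a\<rangle>\<close> and the result in
  \<open>R[x]/\<langle>x\<^sup>n - b\<rangle>\<close> (used for \<open>b = a\<^sup>-\<^sup>1\<close>). Here \<open>f\<close> ranges over all polynomials, not only over those
  of degree below \<open>n\<close>; \<open>reflect_poly f\<close> is \<open>x\<^sup>k f(x\<^sup>-\<^sup>1)\<close> with \<open>k = deg f\<close>, and \<open>reflect_poly 0 = 0\<close>.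
\<close>

definition reciprocal_set ::
    "nat \<Rightarrow> 'r::comm_ring_1 \<Rightarrow> 'r \<Rightarrow> 'r poly set set \<Rightarrow> 'r poly set set" where
  "reciprocal_set n a b J = {cc_class n b (reflect_poly f) | f. cc_class n a f \<in> J}"

text \<open>
  The code in \<open>R\<^sup>n\<close> identified with \<open>J\<close> via \<open>(c\<^sub>0, \<dots>, c\<^sub>n\<^sub>-\<^sub>1) \<mapsto> \<Sum> c\<^sub>i x\<^sup>i\<close>; words are lists of length \<open>n\<close>.
\<close>

definition code_of :: "nat \<Rightarrow> 'r::comm_ring_1 \<Rightarrow> 'r poly set set \<Rightarrow> 'r list set" where
  "code_of n a J = {c. length c = n \<and> cc_class n a (Poly c) \<in> J}"

definition dual_code :: "nat \<Rightarrow> 'r::comm_ring_1 list set \<Rightarrow> 'r list set" where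
  "dual_code n K = {d. length d = n \<and> (\<forall>c\<in>K. (\<Sum>i<n. d ! i * c ! i) = 0)}"

definition cubic :: "'a::comm_ring_1 \<Rightarrow> 'a ruv poly" where
  "cubic a = Polynomial.monom 1 3 - [:emb a:]"

end

theory Submission
  imports Defs "HOL-Computational_Algebra.Primes"
begin

text \<open>
  Put \<open>q = p\<^sup>s\<close>, \<open>w = x\<^sup>3 - \<alpha>\<^sub>0\<close> and \<open>Q = R[x]/\<langle>x\<^sup>n - \<alpha>\<rangle>\<close> with \<open>n = 3q\<close>.

  The ideal structure of \<open>Q\<close> is simple because \<open>v\<close> is redundant. In characteristic \<open>p\<close> one has
  \<open>w\<^sup>q = x\<^sup>n - \<alpha>\<^sub>1\<close>, so in \<open>Q\<close> the power \<open>w\<^sup>q\<close> equals \<open>v (\<alpha>\<^sub>3 + \<alpha>\<^sub>4 u)\<close>, a unit times \<open>v\<close>. Hence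
  \<open>w\<^sup>2\<^sup>q = 0\<close>, every element of \<open>Q\<close> has the form \<open>A + u B\<close> with \<open>A, B \<in> F[x]\<close> (\<open>cong_lift_decomp\<close>), and
  \<open>u C\<close> vanishes only if \<open>w\<^sup>2\<^sup>q\<close> divides \<open>C\<close> (\<open>u_lift_cong_zero\<close>). With these three facts the annihilator of
  \<open>\<langle>w\<^sup>l + u a, u w\<^sup>\<mu>\<rangle>\<close> is read off by division in \<open>F[x]\<close>: it is \<open>\<langle>w\<^sup>2\<^sup>q\<^sup>-\<^sup>\<mu> + u b, u w\<^sup>2\<^sup>q\<^sup>-\<^sup>l\<rangle>\<close> for any \<open>b\<close> that
  makes the two mixed terms cancel (\<open>annihilator_generators\<close>). For \<open>a = w\<^sup>t z\<close> the choice
  \<open>b = - w\<^sup>2\<^sup>q\<^sup>+\<^sup>t\<^sup>-\<^sup>l\<^sup>-\<^sup>\<mu> z\<close> does so.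

  The reciprocal of \<open>f\<close> is \<open>x\<^sup>k f(x\<^sup>-\<^sup>1)\<close> with \<open>k\<close> the degree of \<open>f\<close>. The substitution \<open>x \<mapsto> x\<^sup>-\<^sup>1\<close> is a ring
  isomorphism from \<open>Q\<close> onto \<open>Q' = R[x]/\<langle>x\<^sup>n - \<alpha>\<^sup>-\<^sup>1\<rangle>\<close>, called a flip below. The factor \<open>x\<^sup>k\<close>, which depends on
  the representative, is a unit of finite order in \<open>Q'\<close>, and a representative of suitable degree makes it \<open>1\<close>.
  So the set of reciprocals of an ideal is its image under the flip (\<open>reciprocal_set_eq\<close>), and generators are
  sent to generators, up to units. The flip of \<open>w\<close> is \<open>- \<alpha>\<^sub>0 x\<^sup>-\<^sup>3 (x\<^sup>3 - \<alpha>\<^sub>0\<^sup>-\<^sup>1)\<close>; clearing the powers of \<open>x\<^sup>-\<^sup>1\<close> in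
  the flipped generators gives the claimed ones.

  For the dual code, \<open>\<Sum> c\<^sub>i d\<^sub>i\<close> is the constant coefficient of \<open>c(x) d(x\<^sup>-\<^sup>1)\<close> reduced modulo \<open>x\<^sup>n - \<alpha>\<close>, and the
  other coefficients arise in the same way from the words \<open>x\<^sup>-\<^sup>k c\<close>, which are again in the code. Thus \<open>d\<close> is
  orthogonal to the code exactly if its flip annihilates the ideal (\<open>orthogonal_iff_annihilates\<close>).
\<close>

section \<open>Factor rings of R[x] by x^n - a\<close>

text \<open>
  Equality of cosets is handled as a congruence between polynomials, so that calculations stay in the type-class
  ring and the locale-based factor ring appears only at its interface.
\<close>
definition cc_cong :: "nat \<Rightarrow> 'r::comm_ring_1 \<Rightarrow> 'r poly \<Rightarrow> 'r poly \<Rightarrow> bool" where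
  "cc_cong n a f g \<longleftrightarrow> (Polynomial.monom 1 n - [:a:]) dvd (f - g)"

lemma cc_cong_refl [simp, intro]: "cc_cong n a f f"
  by (simp add: cc_cong_def)

lemma cc_cong_sym: "cc_cong n a f g \<Longrightarrow> cc_cong n a g f"
  unfolding cc_cong_def by (subst dvd_minus_iff [symmetric]) simp

lemma cc_cong_add:
  assumes "cc_cong n a f f'" "cc_cong n a g g'"
  shows "cc_cong n a (f + g) (f' + g')"
  using dvd_add [OF assms [unfolded cc_cong_def]] by (simp add: cc_cong_def add_diff_add)

lemma cc_cong_diff:
  assumes "cc_cong n a f f'" "cc_cong n a g g'"
  shows "cc_cong n a (f - g) (f' - g')"
  using dvd_diff [OF assms [unfolded cc_cong_def]] by (simp add: cc_cong_def algebra_simps)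

lemma cc_cong_trans [trans]:
  assumes "cc_cong n a f g" "cc_cong n a g h"
  shows "cc_cong n a f h"
  using dvd_add [OF assms [unfolded cc_cong_def]] by (simp add: cc_cong_def)

lemma cc_cong_mult:
  assumes "cc_cong n a f f'" "cc_cong n a g g'"
  shows "cc_cong n a (f * g) (f' * g')"
proof -
  have "f * g - f' * g' = (f - f') * g + f' * (g - g')"
    by (simp add: algebra_simps)
  then show ?thesis
    using assms unfolding cc_cong_def by (simp add: dvd_add dvd_mult dvd_mult2)
qed

lemma cc_cong_smult: "cc_cong n a f g \<Longrightarrow> cc_cong n a (smult c f) (smult c g)"
  unfolding cc_cong_def by (simp add: dvd_smult flip: smult_diff_right)

lemma cc_cong_power: "cc_cong n a f g \<Longrightarrow> cc_cong n a (f ^ k) (g ^ k)"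
  by (induction k) (auto intro: cc_cong_mult)

lemma cc_cong_sum:
  "(\<And>i. i \<in> A \<Longrightarrow> cc_cong n a (f i) (g i)) \<Longrightarrow> cc_cong n a (\<Sum>i\<in>A. f i) (\<Sum>i\<in>A. g i)"
  by (induction A rule: infinite_finite_induct) (auto intro: cc_cong_add)

lemma ring_of_type_simps:
  "carrier (ring_of_type_algebra :: 'r::comm_ring_1 ring) = UNIV"
  "x \<otimes>\<^bsub>ring_of_type_algebra\<^esub> y = x * (y :: 'r)"
  "x \<oplus>\<^bsub>ring_of_type_algebra\<^esub> y = x + (y :: 'r)"
  "\<zero>\<^bsub>ring_of_type_algebra\<^esub> = (0 :: 'r)"
  "\<one>\<^bsub>ring_of_type_algebra\<^esub> = (1 :: 'r)"
  by (simp_all add: ring_of_type_algebra_def)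

lemma inv_ring_of_type_algebra:
  assumes "x * y = (1 :: 'r::comm_ring_1)"
  shows "inv\<^bsub>ring_of_type_algebra\<^esub> x = y"
proof -
  interpret R: cring "ring_of_type_algebra :: 'r ring"
    by (rule cring_from_type_algebra)
  show ?thesis
    by (rule R.comm_inv_char) (use assms in \<open>simp_all add: ring_of_type_simps\<close>)
qed

lemma mem_cc_ideal: "f \<in> cc_ideal n a \<longleftrightarrow> (Polynomial.monom 1 n - [:a:]) dvd f"
proof -
  interpret R: cring "ring_of_type_algebra :: 'a poly ring"
    by (rule cring_from_type_algebra)
  show ?thesis
    unfolding cc_ideal_def
    by (subst R.cgenideal_eq_genideal [symmetric])
      (auto simp: cgenideal_def ring_of_type_simps dvd_def mult.commute)
qed

lemma ideal_cc_ideal: "ideal (cc_ideal n a) ring_of_type_algebra"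
proof -
  interpret R: cring "ring_of_type_algebra :: 'a poly ring"
    by (rule cring_from_type_algebra)
  show ?thesis
    unfolding cc_ideal_def by (rule R.genideal_ideal) (simp add: ring_of_type_simps)
qed

text \<open>
  This turns every question about the factor ring into one about congruences.
\<close>
lemma cc_class_eq_iff: "cc_class n a f = cc_class n a g \<longleftrightarrow> cc_cong n a f g"
proof -
  have mem: "h \<in> cc_class n a f \<longleftrightarrow> cc_cong n a h f" for h f
    unfolding cc_class_def a_r_coset_def' cc_cong_def mem_cc_ideal [symmetric]
    by (auto simp: ring_of_type_simps intro!: bexI [of _ "h - f"])
  show ?thesis
  proof
    assume "cc_class n a f = cc_class n a g"
    then show "cc_cong n a f g"
      using mem [of f f] mem [of f g] by simp
  next
    assume fg: "cc_cong n a f g"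
    have "h \<in> cc_class n a f \<longleftrightarrow> h \<in> cc_class n a g" for h
      unfolding mem
      using cc_cong_trans [OF _ fg, of h] cc_cong_trans [OF _ cc_cong_sym [OF fg], of h] by blast
    then show "cc_class n a f = cc_class n a g"
      by blast
  qed
qed

lemma cring_cc_ring: "cring (cc_ring n a)"
  unfolding cc_ring_def
  by (rule ideal.quotient_is_cring [OF ideal_cc_ideal [of n a] cring_from_type_algebra])

lemma cc_class_hom: "ring_hom_cring ring_of_type_algebra (cc_ring n a) (cc_class n a)"
  using ideal.rcos_ring_hom_cring [OF ideal_cc_ideal [of n a] cring_from_type_algebra]
  unfolding cc_ring_def cc_class_def .

lemma carrier_cc_ring: "carrier (cc_ring n a) = range (cc_class n a)"
  unfolding cc_ring_def cc_class_def FactRing_def partial_object.simps A_RCOSETS_def' ring_of_type_simps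
  by (rule UNION_singleton_eq_range)

lemma cc_class_in_carrier [simp]: "cc_class n a f \<in> carrier (cc_ring n a)"
  by (simp add: carrier_cc_ring)

lemma cc_class_ops:
  "cc_class n a f \<otimes>\<^bsub>cc_ring n a\<^esub> cc_class n a g = cc_class n a (f * g)"
  "cc_class n a f \<oplus>\<^bsub>cc_ring n a\<^esub> cc_class n a g = cc_class n a (f + g)"
  "\<zero>\<^bsub>cc_ring n a\<^esub> = cc_class n a 0"
  "\<one>\<^bsub>cc_ring n a\<^esub> = cc_class n a 1"
proof -
  interpret H: ring_hom_cring ring_of_type_algebra "cc_ring n a" "cc_class n a"
    by (rule cc_class_hom)
  note H.hom_mult [of f g] H.hom_add [of f g] H.hom_zero H.hom_one
  then show
    "cc_class n a f \<otimes>\<^bsub>cc_ring n a\<^esub> cc_class n a g = cc_class n a (f * g)"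
    "cc_class n a f \<oplus>\<^bsub>cc_ring n a\<^esub> cc_class n a g = cc_class n a (f + g)"
    "\<zero>\<^bsub>cc_ring n a\<^esub> = cc_class n a 0"
    "\<one>\<^bsub>cc_ring n a\<^esub> = cc_class n a 1"
    by (simp_all add: ring_of_type_simps)
qed

text \<open>
  The linear combinations of two cosets already form an ideal, because every coset has a representative.
\<close>
lemma genideal_pair:
  "genideal (cc_ring n a) {cc_class n a f, cc_class n a g}
    = {cc_class n a (b * f + c * g) | b c. True}" (is "?L = ?R")
proof
  interpret Q: cring "cc_ring n a" by (rule cring_cc_ring)
  have "ideal ?R (cc_ring n a)"
  proof (rule idealI)
    show "subgroup ?R (add_monoid (cc_ring n a))"
    proof (rule Q.add.subgroupI)
      show "?R \<noteq> {}" by blast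
      fix x assume "x \<in> ?R"
      then obtain b c where x: "x = cc_class n a (b * f + c * g)" by blast
      have "\<ominus>\<^bsub>cc_ring n a\<^esub> x = cc_class n a ((- b) * f + (- c) * g)"
        by (rule Q.minus_equality) (simp_all add: x cc_class_ops)
      then show "\<ominus>\<^bsub>cc_ring n a\<^esub> x \<in> ?R" by blast
    next
      fix x y assume "x \<in> ?R" "y \<in> ?R"
      then obtain b c b' c' where "x = cc_class n a (b * f + c * g)" "y = cc_class n a (b' * f + c' * g)"
        by blast
      then have "x \<oplus>\<^bsub>cc_ring n a\<^esub> y = cc_class n a ((b + b') * f + (c + c') * g)"
        by (simp add: cc_class_ops algebra_simps)
      then show "x \<oplus>\<^bsub>cc_ring n a\<^esub> y \<in> ?R" by blast
    qed auto
    fix x y assume "x \<in> ?R" "y \<in> carrier (cc_ring n a)"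
    then obtain b c h where xy: "x = cc_class n a (b * f + c * g)" "y = cc_class n a h"
      by (auto simp: carrier_cc_ring)
    then have "y \<otimes>\<^bsub>cc_ring n a\<^esub> x = cc_class n a ((h * b) * f + (h * c) * g)"
      by (simp add: cc_class_ops algebra_simps)
    then show "y \<otimes>\<^bsub>cc_ring n a\<^esub> x \<in> ?R" by blast
    then show "x \<otimes>\<^bsub>cc_ring n a\<^esub> y \<in> ?R"
      by (simp add: xy cc_class_ops mult.commute)
  qed (rule Q.ring_axioms)
  moreover have "cc_class n a f = cc_class n a (1 * f + 0 * g)"
    "cc_class n a g = cc_class n a (0 * f + 1 * g)"
    by simp_all
  then have "{cc_class n a f, cc_class n a g} \<subseteq> ?R" by blast
  ultimately show "?L \<subseteq> ?R" by (rule Q.genideal_minimal)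
  interpret I: ideal ?L "cc_ring n a"
    by (rule Q.genideal_ideal) simp
  have mem: "cc_class n a f \<in> ?L" "cc_class n a g \<in> ?L"
    using Q.genideal_self [of "{cc_class n a f, cc_class n a g}"] by auto
  show "?R \<subseteq> ?L"
  proof
    fix x assume "x \<in> ?R"
    then obtain b c where "x = cc_class n a (b * f + c * g)" by blast
    then have "x = cc_class n a b \<otimes>\<^bsub>cc_ring n a\<^esub> cc_class n a f
        \<oplus>\<^bsub>cc_ring n a\<^esub> cc_class n a c \<otimes>\<^bsub>cc_ring n a\<^esub> cc_class n a g"
      by (simp add: cc_class_ops)
    then show "x \<in> ?L"
      using mem by (simp add: I.I_l_closed)
  qed
qed

lemma cc_class_mem_genideal_pair:
  "cc_class n a h \<in> genideal (cc_ring n a) {cc_class n a f, cc_class n a g}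
    \<longleftrightarrow> (\<exists>b c. cc_cong n a h (b * f + c * g))"
  unfolding genideal_pair mem_Collect_eq cc_class_eq_iff by simp

lemma cc_class_mem_annihilator:
  assumes "J \<subseteq> carrier (cc_ring n a)"
  shows "cc_class n a f \<in> annihilator (cc_ring n a) J
    \<longleftrightarrow> (\<forall>g. cc_class n a g \<in> J \<longrightarrow> cc_cong n a (f * g) 0)"
proof -
  have "(\<forall>c\<in>J. cc_class n a f \<otimes>\<^bsub>cc_ring n a\<^esub> c = \<zero>\<^bsub>cc_ring n a\<^esub>)
    \<longleftrightarrow> (\<forall>g. cc_class n a g \<in> J
      \<longrightarrow> cc_class n a f \<otimes>\<^bsub>cc_ring n a\<^esub> cc_class n a g = \<zero>\<^bsub>cc_ring n a\<^esub>)"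
    using assms unfolding carrier_cc_ring by blast
  then show ?thesis
    unfolding annihilator_def cc_class_ops cc_class_eq_iff by simp
qed

lemma genideal_pair_closed:
  assumes "cc_class n a h \<in> genideal (cc_ring n a) {cc_class n a f, cc_class n a g}"
  shows "cc_class n a (k * h) \<in> genideal (cc_ring n a) {cc_class n a f, cc_class n a g}"
proof -
  obtain b c where "cc_cong n a h (b * f + c * g)"
    using assms by (auto simp only: cc_class_mem_genideal_pair)
  from cc_cong_mult [OF cc_cong_refl [of n a k] this]
  have "cc_cong n a (k * h) (k * b * f + k * c * g)"
    by (simp only: distrib_left mult.assoc)
  then show ?thesis
    by (auto simp only: cc_class_mem_genideal_pair)
qed

lemma annihilator_closed:
  assumes "J \<subseteq> carrier (cc_ring n a)" "cc_class n a f \<in> annihilator (cc_ring n a) J"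
  shows "cc_class n a (h * f) \<in> annihilator (cc_ring n a) J"
  unfolding cc_class_mem_annihilator [OF assms(1)]
proof (intro allI impI)
  fix g assume "cc_class n a g \<in> J"
  then have "cc_cong n a (f * g) 0"
    using assms(2) unfolding cc_class_mem_annihilator [OF assms(1)] by blast
  from cc_cong_mult [OF cc_cong_refl [of n a h] this] show "cc_cong n a (h * f * g) 0"
    by (simp add: mult.assoc)
qed

text \<open>
  Annihilating is inherited by linear combinations, so testing the two generators is enough.
\<close>
lemma cc_class_mem_annihilator_genideal_pair:
  "cc_class n a h \<in> annihilator (cc_ring n a) (genideal (cc_ring n a) {cc_class n a f, cc_class n a g})
    \<longleftrightarrow> cc_cong n a (h * f) 0 \<and> cc_cong n a (h * g) 0"
    (is "_ \<in> annihilator _ ?I \<longleftrightarrow> _")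
proof -
  have carrier: "?I \<subseteq> carrier (cc_ring n a)"
    by (auto simp: genideal_pair)
  have "(\<forall>k. cc_class n a k \<in> ?I \<longrightarrow> cc_cong n a (h * k) 0)
      \<longleftrightarrow> cc_cong n a (h * f) 0 \<and> cc_cong n a (h * g) 0"
  proof (intro iffI allI impI)
    assume ann: "\<forall>k. cc_class n a k \<in> ?I \<longrightarrow> cc_cong n a (h * k) 0"
    have "cc_cong n a f (1 * f + 0 * g)" "cc_cong n a g (0 * f + 1 * g)"
      by simp_all
    then have "cc_class n a f \<in> ?I" "cc_class n a g \<in> ?I"
      unfolding cc_class_mem_genideal_pair by blast+
    with ann show "cc_cong n a (h * f) 0 \<and> cc_cong n a (h * g) 0"
      by blast
  next
    fix k assume hfg: "cc_cong n a (h * f) 0 \<and> cc_cong n a (h * g) 0" and "cc_class n a k \<in> ?I"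
    then obtain b c where k: "cc_cong n a k (b * f + c * g)"
      by (auto simp only: cc_class_mem_genideal_pair)
    have "cc_cong n a (h * k) (h * (b * f + c * g))"
      by (intro cc_cong_mult cc_cong_refl k)
    also have "h * (b * f + c * g) = b * (h * f) + c * (h * g)"
      by (simp only: distrib_left mult_ac)
    also have "cc_cong n a \<dots> (b * 0 + c * 0)"
      using hfg by (intro cc_cong_add cc_cong_mult cc_cong_refl) simp_all
    finally show "cc_cong n a (h * k) 0"
      by simp
  qed
  then show ?thesis
    unfolding cc_class_mem_annihilator [OF carrier] .
qed

section \<open>Reduction modulo x^n - a and inversion of x\<close>

lemma cc_cong_monom: "cc_cong n a (Polynomial.monom 1 n) [:a:]"
  by (simp add: cc_cong_def)

lemma coeff_modulus_top:
  fixes a :: "'r::comm_ring_1"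
  assumes "0 < n"
  shows "Polynomial.degree (Polynomial.monom 1 n - [:a:]) = n"
    and "lead_coeff (Polynomial.monom 1 n - [:a:]) = 1"
proof -
  have top: "Polynomial.coeff (Polynomial.monom 1 n - [:a:]) n = 1"
    using assms by (cases n) simp_all
  show deg: "Polynomial.degree (Polynomial.monom 1 n - [:a:]) = n"
  proof (rule antisym)
    show "Polynomial.degree (Polynomial.monom 1 n - [:a:]) \<le> n"
      by (rule degree_diff_le) (simp_all add: degree_monom_le)
    show "n \<le> Polynomial.degree (Polynomial.monom 1 n - [:a:])"
      using top by (intro le_degree) simp
  qed
  show "lead_coeff (Polynomial.monom 1 n - [:a:]) = 1"
    unfolding deg by (rule top)
qed

text \<open>
  The modulus is monic, so a nonzero multiple of it has degree at least \<open>n\<close>, even though \<open>R\<close> has zero divisors.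
\<close>
lemma cc_cong_unique:
  assumes "cc_cong n a f g" "Polynomial.degree f < n" "Polynomial.degree g < n"
  shows "f = g"
proof (rule ccontr)
  assume "f \<noteq> g"
  let ?P = "Polynomial.monom 1 n - [:a:]"
  have n: "0 < n" using assms(2) by simp
  from assms(1) obtain h where h: "f - g = ?P * h"
    by (auto simp: cc_cong_def dvd_def)
  with \<open>f \<noteq> g\<close> have "h \<noteq> 0" by auto
  then have "Polynomial.coeff (f - g) (n + Polynomial.degree h) \<noteq> 0"
    using coeff_mult_degree_sum [of ?P h] coeff_modulus_top [OF n, of a] by (simp add: h)
  moreover have "Polynomial.degree (f - g) < n"
    using assms(2,3) by (rule degree_diff_less)
  ultimately show False
    using coeff_eq_0 [of "f - g" "n + Polynomial.degree h"] by simp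
qed

text \<open>
  Each monomial \<open>x\<^sup>k\<close> is reduced explicitly, to \<open>a\<close> to the power \<open>k div n\<close> times \<open>x\<close> to the power \<open>k mod n\<close>;
  this avoids a division algorithm over a ring that is not a field.
\<close>
lemma cc_cong_reduce:
  assumes "0 < n"
  obtains r where "Polynomial.degree r < n" "cc_cong n a f r"
proof
  let ?r = "\<Sum>k\<le>Polynomial.degree f.
    Polynomial.monom (Polynomial.coeff f k * a ^ (k div n)) (k mod n)"
  show "Polynomial.degree ?r < n"
    using assms by (intro degree_sum_less) (auto intro: le_less_trans [OF degree_monom_le])
  have "cc_cong n a (Polynomial.monom c k) (Polynomial.monom (c * a ^ (k div n)) (k mod n))" for c k
  proof -
    have "cc_cong n a (smult c (Polynomial.monom 1 (k mod n) * Polynomial.monom 1 n ^ (k div n)))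
        (smult c (Polynomial.monom 1 (k mod n) * [:a:] ^ (k div n)))"
      by (intro cc_cong_smult cc_cong_mult cc_cong_power cc_cong_monom cc_cong_refl)
    then show ?thesis
      by (simp add: monom_power mult_monom smult_monom poly_const_pow mult.commute)
  qed
  then have "cc_cong n a (\<Sum>k\<le>Polynomial.degree f. Polynomial.monom (Polynomial.coeff f k) k) ?r"
    by (intro cc_cong_sum)
  then show "cc_cong n a f ?r"
    by (simp add: poly_as_sum_of_monoms)
qed

text \<open>
  The substitution \<open>x \<mapsto> x\<^sup>-\<^sup>1\<close>. Modulo \<open>x\<^sup>n - b\<close> with \<open>a b = 1\<close>, the inverse of \<open>x\<close> is \<open>a x\<^sup>n\<^sup>-\<^sup>1\<close>, so it is the
  substitution of a polynomial. A flip with parameter \<open>a\<close> leads from residues modulo \<open>x\<^sup>n - a\<close> to residues modulo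
  \<open>x\<^sup>n - b\<close>.
\<close>
definition cc_flip :: "nat \<Rightarrow> 'r::comm_ring_1 \<Rightarrow> 'r poly \<Rightarrow> 'r poly" where
  "cc_flip n a f = pcompose f (Polynomial.monom a (n - 1))"

lemma cc_flip_simps:
  "cc_flip n a 0 = 0"
  "cc_flip n a 1 = 1"
  "cc_flip n a [:c:] = [:c:]"
  "cc_flip n a (f + g) = cc_flip n a f + cc_flip n a g"
  "cc_flip n a (f - g) = cc_flip n a f - cc_flip n a g"
  "cc_flip n a (f * g) = cc_flip n a f * cc_flip n a g"
  "cc_flip n a (smult c f) = smult c (cc_flip n a f)"
  by (simp_all add: cc_flip_def pcompose_add pcompose_diff pcompose_mult pcompose_smult pcompose_1)

lemma cc_flip_power: "cc_flip n a (f ^ k) = cc_flip n a f ^ k"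
  by (induction k) (simp_all add: cc_flip_simps)

lemma cc_flip_sum: "cc_flip n a (\<Sum>i\<in>A. f i) = (\<Sum>i\<in>A. cc_flip n a (f i))"
  by (simp add: cc_flip_def pcompose_sum)

lemma cc_flip_monom: "cc_flip n a (Polynomial.monom c k) = smult c (Polynomial.monom a (n - 1) ^ k)"
proof -
  have "cc_flip n a (Polynomial.monom 1 1) = Polynomial.monom a (n - 1)"
    by (simp add: cc_flip_def monom_Suc monom_0 pcompose_pCons)
  moreover have "Polynomial.monom c k = smult c (Polynomial.monom 1 1 ^ k)"
    by (simp add: monom_power smult_monom)
  ultimately show ?thesis
    by (simp only: cc_flip_simps cc_flip_power)
qed

lemma pcompose_cc_cong: "cc_cong n a g h \<Longrightarrow> cc_cong n a (pcompose f g) (pcompose f h)"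
  by (induction f) (auto simp: pcompose_pCons intro: cc_cong_add cc_cong_mult)

locale reciprocal_pair =
  fixes n :: nat and a b :: "'r::comm_ring_1"
  assumes n_pos: "0 < n" and ab: "a * b = 1"
begin

lemma swap: "reciprocal_pair n b a"
  using n_pos ab by unfold_locales (simp_all add: mult.commute)

lemma X_inverse_power:
  "cc_cong n a (Polynomial.monom 1 k * Polynomial.monom b (n - 1) ^ k) 1"
proof -
  have "cc_cong n a (smult b (Polynomial.monom 1 n)) (smult b [:a:])"
    by (intro cc_cong_smult cc_cong_monom)
  moreover have "smult b (Polynomial.monom 1 n) = Polynomial.monom 1 1 * Polynomial.monom b (n - 1)"
    using n_pos by (simp add: mult_monom smult_monom)
  ultimately have "cc_cong n a (Polynomial.monom 1 1 * Polynomial.monom b (n - 1)) 1"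
    using ab by (simp add: mult.commute one_pCons)
  then have "cc_cong n a ((Polynomial.monom 1 1 * Polynomial.monom b (n - 1)) ^ k) (1 ^ k)"
    by (rule cc_cong_power)
  then show ?thesis
    by (simp add: power_mult_distrib monom_power [of 1 "Suc 0" k])
qed

text \<open>
  With \<open>y\<close> the inverse of \<open>x\<close> modulo \<open>x\<^sup>n - b\<close>, the relation \<open>x\<^sup>n = b\<close> becomes \<open>y\<^sup>n = a\<close>, so the flip sends the modulus
  \<open>x\<^sup>n - a\<close> to a multiple of \<open>x\<^sup>n - b\<close>.
\<close>
lemma cc_flip_cong:
  assumes "cc_cong n a f g"
  shows "cc_cong n b (cc_flip n a f) (cc_flip n a g)"
proof -
  interpret S: reciprocal_pair n b a by (rule swap)
  let ?y = "Polynomial.monom a (n - 1)"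
  from assms obtain h where h: "f = g + (Polynomial.monom 1 n - [:a:]) * h"
    by (auto simp: cc_cong_def dvd_def algebra_simps)
  \<comment> \<open>The inserted \<open>b\<close> is replaced by \<open>x\<^sup>n\<close>, which cancels \<open>y\<^sup>n\<close>.\<close>
  have "cc_cong n b ([:a:] * ([:b:] * ?y ^ n)) ([:a:] * (Polynomial.monom 1 n * ?y ^ n))"
    by (intro cc_cong_mult cc_cong_refl cc_cong_sym [OF cc_cong_monom])
  also have "cc_cong n b \<dots> ([:a:] * 1)"
    by (intro cc_cong_mult cc_cong_refl S.X_inverse_power)
  also have "[:a:] * ([:b:] * ?y ^ n) = ?y ^ n"
    using ab by (simp add: mult.commute [of b a])
  finally have "cc_cong n b (cc_flip n a g + (?y ^ n - [:a:]) * cc_flip n a h)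
      (cc_flip n a g + ([:a:] - [:a:]) * cc_flip n a h)"
    by (intro cc_cong_add cc_cong_mult cc_cong_diff cc_cong_refl) simp
  then show ?thesis
    by (simp add: h cc_flip_simps cc_flip_monom)
qed

text \<open>
  The second flip sends the inverse of \<open>x\<close> to the inverse of the inverse of \<open>x\<close>, that is, to \<open>x\<close>. Both flips are
  therefore isomorphisms of the factor rings, inverse to each other.
\<close>
lemma cc_flip_flip: "cc_cong n a (cc_flip n b (cc_flip n a f)) f"
proof -
  interpret S: reciprocal_pair n b a by (rule swap)
  let ?x = "Polynomial.monom 1 1 :: 'r poly"
  let ?y = "Polynomial.monom a (n - 1)" and ?y' = "Polynomial.monom b (n - 1)"
  have xy: "cc_cong n a (?x * ?y') 1"
    using X_inverse_power [of 1] by simp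
  have "cc_cong n a (cc_flip n b (?x * ?y)) (cc_flip n b 1)"
    using S.cc_flip_cong [OF S.X_inverse_power [of 1]] by simp
  then have flip: "cc_cong n a (?y' * cc_flip n b ?y) 1"
    by (simp add: cc_flip_simps cc_flip_monom)
  \<comment> \<open>Inverses are unique: \<open>flip y\<close> and \<open>x\<close> are both inverse to \<open>y'\<close>.\<close>
  have "cc_cong n a (1 * cc_flip n b ?y) (?x * ?y' * cc_flip n b ?y)"
    by (intro cc_cong_mult cc_cong_refl cc_cong_sym [OF xy])
  also have "?x * ?y' * cc_flip n b ?y = ?x * (?y' * cc_flip n b ?y)"
    by (simp add: mult.assoc)
  also have "cc_cong n a \<dots> (?x * 1)"
    by (intro cc_cong_mult cc_cong_refl flip)
  finally have "cc_cong n a (pcompose ?y ?y') [:0, 1:]"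
    by (simp add: cc_flip_def monom_Suc monom_0)
  then have "cc_cong n a (pcompose f (pcompose ?y ?y')) (pcompose f [:0, 1:])"
    by (rule pcompose_cc_cong)
  then show ?thesis
    by (simp add: cc_flip_def pcompose_assoc)
qed

text \<open>
  This is the formula \<open>f\<^sup>* = x\<^sup>k f(x\<^sup>-\<^sup>1)\<close>, read in the factor ring, where \<open>x\<^sup>-\<^sup>1\<close> exists.
\<close>
lemma reflect_poly_cong:
  "cc_cong n b (reflect_poly f) (Polynomial.monom 1 (Polynomial.degree f) * cc_flip n a f)"
proof (induction f)
  case 0
  then show ?case by (simp add: cc_flip_simps)
next
  case (pCons c f)
  interpret S: reciprocal_pair n b a by (rule swap)
  let ?y = "Polynomial.monom a (n - 1)" and ?d = "Polynomial.degree f"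
  show ?case
  proof (cases "f = 0")
    case True
    then show ?thesis by (simp add: cc_flip_simps monom_0)
  next
    case False
    have "cc_cong n b (1 * (Polynomial.monom 1 ?d * cc_flip n a f))
        (Polynomial.monom 1 1 * ?y * (Polynomial.monom 1 ?d * cc_flip n a f))"
      using S.X_inverse_power [of 1] by (intro cc_cong_mult cc_cong_refl) (simp add: cc_cong_sym)
    from cc_cong_trans [OF pCons.IH this [unfolded mult_1_left]]
    have "cc_cong n b (reflect_poly f)
        (Polynomial.monom 1 1 * ?y * (Polynomial.monom 1 ?d * cc_flip n a f))" .
    then have "cc_cong n b (reflect_poly f + Polynomial.monom c (Suc ?d))
        (Polynomial.monom 1 1 * ?y * (Polynomial.monom 1 ?d * cc_flip n a f)
          + Polynomial.monom c (Suc ?d))"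
      by (intro cc_cong_add cc_cong_refl)
    moreover have "Polynomial.monom 1 1 * ?y * (Polynomial.monom 1 ?d * cc_flip n a f)
          + Polynomial.monom c (Suc ?d)
        = Polynomial.monom 1 (Suc ?d) * ([:c:] + ?y * cc_flip n a f)"
    proof -
      have "Polynomial.monom 1 (Suc ?d) = Polynomial.monom 1 1 * Polynomial.monom (1::'r) ?d"
        by (simp add: mult_monom)
      moreover have "Polynomial.monom c (Suc ?d) = Polynomial.monom 1 (Suc ?d) * [:c:]"
        by (simp add: smult_monom)
      ultimately show ?thesis
        by (simp only: algebra_simps)
    qed
    ultimately show ?thesis
      using False by (simp add: reflect_poly_pCons' cc_flip_def pcompose_pCons)
  qed
qed

text \<open>
  The reciprocal of a representative \<open>f\<close> is the flip of \<open>f\<close> times \<open>x\<close> to the degree of \<open>f\<close>, and \<open>J\<close> absorbs such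
  factors. Conversely, adding \<open>(x\<^sup>n - a) x\<^sup>d\<^sup>-\<^sup>n\<close> to \<open>f\<close> changes its degree to any large \<open>d\<close> without changing its coset.
  Since \<open>a\<close> has finite order, so has \<open>x\<close>; a multiple \<open>d\<close> of that order makes the extra factor \<open>1\<close>.
\<close>
lemma reciprocal_set_eq:
  assumes ord: "a ^ e = 1" "0 < e"
    and J: "\<And>f h. cc_class n a f \<in> J \<Longrightarrow> cc_class n a (h * f) \<in> J"
  shows "reciprocal_set n a b J = {cc_class n b g | g. cc_class n a (cc_flip n b g) \<in> J}"
proof (intro subset_antisym subsetI)
  fix y assume "y \<in> reciprocal_set n a b J"
  then obtain f where y: "y = cc_class n b (reflect_poly f)" and f: "cc_class n a f \<in> J"
    by (auto simp: reciprocal_set_def)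
  interpret S: reciprocal_pair n b a by (rule swap)
  let ?u = "cc_flip n b (Polynomial.monom 1 (Polynomial.degree f))"
  have "cc_cong n a (cc_flip n b (reflect_poly f)) (?u * cc_flip n b (cc_flip n a f))"
    using S.cc_flip_cong [OF reflect_poly_cong] by (simp add: cc_flip_simps)
  also have "cc_cong n a \<dots> (?u * f)"
    by (intro cc_cong_mult cc_cong_refl cc_flip_flip)
  finally have "cc_class n a (cc_flip n b (reflect_poly f)) \<in> J"
    using J [OF f, of ?u] by (simp only: cc_class_eq_iff [symmetric])
  with y show "y \<in> {cc_class n b g | g. cc_class n a (cc_flip n b g) \<in> J}"
    by blast
next
  fix y assume "y \<in> {cc_class n b g | g. cc_class n a (cc_flip n b g) \<in> J}"
  then obtain g where y: "y = cc_class n b g" and g: "cc_class n a (cc_flip n b g) \<in> J"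
    by blast
  interpret S: reciprocal_pair n b a by (rule swap)
  define f0 where "f0 = cc_flip n b g"
  define d where "d = n * e * Suc (Polynomial.degree f0)"
  have d: "n \<le> d" "Polynomial.degree f0 < d"
  proof -
    have "1 * 1 \<le> e * Suc (Polynomial.degree f0)"
      using ord by (intro mult_le_mono) auto
    then show "n \<le> d"
      unfolding d_def mult.assoc using mult_le_mono2 [of 1 _ n] by simp
    have "1 * Suc (Polynomial.degree f0) \<le> n * e * Suc (Polynomial.degree f0)"
      using n_pos ord by (intro mult_le_mono1) simp
    then show "Polynomial.degree f0 < d"
      unfolding d_def by simp
  qed
  define f where "f = f0 + (Polynomial.monom 1 n - [:a:]) * Polynomial.monom 1 (d - n)"
  have f_eq: "f = (f0 - Polynomial.monom a (d - n)) + Polynomial.monom 1 d"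
    using d by (simp add: f_def algebra_simps mult_monom smult_monom)
  have "Polynomial.degree (f0 - Polynomial.monom a (d - n)) < d"
    using d n_pos by (intro degree_diff_less) (auto intro: le_less_trans [OF degree_monom_le])
  then have deg: "Polynomial.degree f = d"
    unfolding f_eq by (subst degree_add_eq_right) (simp_all add: degree_monom_eq)
  have "b ^ e = 1"
    using power_mult_distrib [of a b e] by (simp add: ab ord)
  then have xd: "cc_cong n b (Polynomial.monom 1 d) 1"
    using cc_cong_power [OF cc_cong_monom, of n b "e * Suc (Polynomial.degree f0)"]
    unfolding d_def monom_power poly_const_pow mult.assoc power_mult by (simp add: one_pCons)
  have ff0: "cc_cong n a f f0"
    by (simp add: f_def cc_cong_def)
  then have "cc_class n a f = cc_class n a f0"
    by (simp only: cc_class_eq_iff)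
  with g have "cc_class n a f \<in> J"
    by (simp only: f0_def)
  moreover have "cc_cong n b (reflect_poly f) g"
  proof -
    have "cc_cong n b (reflect_poly f) (Polynomial.monom 1 d * cc_flip n a f)"
      using reflect_poly_cong [of f] by (simp add: deg)
    also have "cc_cong n b \<dots> (1 * cc_flip n a f0)"
      by (intro cc_cong_mult xd cc_flip_cong ff0)
    also have "1 * cc_flip n a f0 = cc_flip n a (cc_flip n b g)"
      by (simp add: f0_def)
    also have "cc_cong n b \<dots> g"
      by (rule S.cc_flip_flip)
    finally show ?thesis .
  qed
  ultimately show "y \<in> reciprocal_set n a b J"
    unfolding reciprocal_set_def y by (auto simp: cc_class_eq_iff intro: cc_cong_sym)
qed

lemma cc_class_mem_reciprocal_set:
  assumes "a ^ e = 1" "0 < e"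
    and "\<And>f h. cc_class n a f \<in> J \<Longrightarrow> cc_class n a (h * f) \<in> J"
  shows "cc_class n b g \<in> reciprocal_set n a b J \<longleftrightarrow> cc_class n a (cc_flip n b g) \<in> J"
proof -
  interpret S: reciprocal_pair n b a by (rule swap)
  have flip_eq: "cc_class n a (cc_flip n b g) = cc_class n a (cc_flip n b h)"
    if "cc_class n b g = cc_class n b h" for h
    using that S.cc_flip_cong by (simp only: cc_class_eq_iff)
  have "reciprocal_set n a b J = {cc_class n b g | g. cc_class n a (cc_flip n b g) \<in> J}"
    using assms by (rule reciprocal_set_eq)
  then have "cc_class n b g \<in> reciprocal_set n a b J
      \<longleftrightarrow> (\<exists>h. cc_class n b g = cc_class n b h \<and> cc_class n a (cc_flip n b h) \<in> J)"
    by simp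
  also have "\<dots> \<longleftrightarrow> cc_class n a (cc_flip n b g) \<in> J"
  proof
    assume "\<exists>h. cc_class n b g = cc_class n b h \<and> cc_class n a (cc_flip n b h) \<in> J"
    then obtain h where "cc_class n b g = cc_class n b h" "cc_class n a (cc_flip n b h) \<in> J"
      by blast
    then show "cc_class n a (cc_flip n b g) \<in> J"
      by (simp only: flip_eq)
  qed blast
  finally show ?thesis .
qed

end

section \<open>Duals of constacyclic codes\<close>

context reciprocal_pair
begin

text \<open>
  The point of this normal form is that both cases have degree below \<open>n\<close>, and that its constant coefficient is
  nonzero only for \<open>i = j\<close>.
\<close>
lemma monom_mult_inverse_power:
  assumes "i < n" "j < n"
  shows "cc_cong n a (Polynomial.monom 1 i * Polynomial.monom b (n - 1) ^ j)
    (if j \<le> i then Polynomial.monom 1 (i - j) else Polynomial.monom b (n - (j - i)))"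
proof -
  let ?y = "Polynomial.monom b (n - 1)"
  have up: "cc_cong n a (Polynomial.monom 1 (k + j) * ?y ^ j) (Polynomial.monom 1 k)" for k j
  proof -
    have "cc_cong n a (Polynomial.monom 1 k * (Polynomial.monom 1 j * ?y ^ j)) (Polynomial.monom 1 k * 1)"
      by (intro cc_cong_mult cc_cong_refl X_inverse_power)
    moreover have "Polynomial.monom 1 (k + j) = Polynomial.monom 1 k * Polynomial.monom (1::'r) j"
      by (simp add: mult_monom)
    ultimately show ?thesis
      by (simp only: mult.assoc mult_1_right)
  qed
  show ?thesis
  proof (cases "j \<le> i")
    case True
    then show ?thesis using up [of "i - j" j] by simp
  next
    case False
    \<comment> \<open>For \<open>i < j\<close> the factor \<open>b x\<^sup>n = 1\<close> supplies the missing powers of \<open>x\<close>.\<close>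
    then have j: "n + i = (n - (j - i)) + j"
      using assms by simp
    have "cc_cong n a (smult b (Polynomial.monom 1 n * (Polynomial.monom 1 i * ?y ^ j)))
        (smult b ([:a:] * (Polynomial.monom 1 i * ?y ^ j)))"
      by (intro cc_cong_smult cc_cong_mult cc_cong_refl cc_cong_monom)
    then have "cc_cong n a (smult b (Polynomial.monom 1 (n + i) * ?y ^ j)) (Polynomial.monom 1 i * ?y ^ j)"
      using ab by (simp add: mult_monom mult.commute [of b a] flip: mult.assoc)
    from cc_cong_trans [OF cc_cong_sym [OF this] cc_cong_smult [OF up [of "n - (j - i)" j, folded j]]]
    show ?thesis
      using False by (simp add: smult_monom)
  qed
qed

lemma poly_eq_sum_monom:
  fixes f :: "'r poly"
  assumes "Polynomial.degree f < n"
  shows "f = (\<Sum>i<n. Polynomial.monom (Polynomial.coeff f i) i)"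
  using poly_as_sum_of_monoms' [of f "n - 1"] assms n_pos
  by (cases n) (simp_all add: lessThan_Suc_atMost)

text \<open>
  The standard inner product of two words as a constant coefficient. Multiply out \<open>f(x) g(x\<^sup>-\<^sup>1)\<close>: the terms
  \<open>x\<^sup>i x\<^sup>-\<^sup>j\<close> with \<open>i \<noteq> j\<close> reduce to monomials of positive degree.
\<close>
lemma constant_coeff_mult_flip:
  assumes "Polynomial.degree f < n" "Polynomial.degree g < n"
  obtains r where "Polynomial.degree r < n" "cc_cong n a (f * cc_flip n b g) r"
    "Polynomial.coeff r 0 = (\<Sum>i<n. Polynomial.coeff f i * Polynomial.coeff g i)"
proof
  let ?E = "\<lambda>i j. if j \<le> i then Polynomial.monom 1 (i - j) else Polynomial.monom b (n - (j - i))"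
  let ?r = "\<Sum>i<n. \<Sum>j<n. smult (Polynomial.coeff f i * Polynomial.coeff g j) (?E i j)"
  have "f * cc_flip n b g = (\<Sum>i<n. Polynomial.monom (Polynomial.coeff f i) i)
      * cc_flip n b (\<Sum>j<n. Polynomial.monom (Polynomial.coeff g j) j)"
    using poly_eq_sum_monom [OF assms(1)] poly_eq_sum_monom [OF assms(2)] by simp
  also have "\<dots> = (\<Sum>i<n. \<Sum>j<n. Polynomial.monom (Polynomial.coeff f i) i
      * smult (Polynomial.coeff g j) (Polynomial.monom b (n - 1) ^ j))"
    by (simp only: cc_flip_sum cc_flip_monom sum_product)
  also have "\<dots> = (\<Sum>i<n. \<Sum>j<n. smult (Polynomial.coeff f i * Polynomial.coeff g j)
      (Polynomial.monom 1 i * Polynomial.monom b (n - 1) ^ j))"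
  proof (intro sum.cong refl)
    fix i j
    have "Polynomial.monom (Polynomial.coeff f i) i = smult (Polynomial.coeff f i) (Polynomial.monom 1 i)"
      by (simp add: smult_monom)
    then show "Polynomial.monom (Polynomial.coeff f i) i
          * smult (Polynomial.coeff g j) (Polynomial.monom b (n - 1) ^ j)
        = smult (Polynomial.coeff f i * Polynomial.coeff g j)
            (Polynomial.monom 1 i * Polynomial.monom b (n - 1) ^ j)"
      by (simp add: mult.commute)
  qed
  finally show "cc_cong n a (f * cc_flip n b g) ?r"
    by (simp only:) (intro cc_cong_sum cc_cong_smult monom_mult_inverse_power; simp)
  show "Polynomial.degree ?r < n"
    using n_pos
    by (intro degree_sum_less le_less_trans [OF degree_smult_le])
      (auto intro: le_less_trans [OF degree_monom_le])
  have "Polynomial.coeff ?r 0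
      = (\<Sum>i<n. \<Sum>j<n. if i = j then Polynomial.coeff f i * Polynomial.coeff g j else 0)"
    unfolding coeff_sum coeff_smult by (intro sum.cong refl) auto
  then show "Polynomial.coeff ?r 0 = (\<Sum>i<n. Polynomial.coeff f i * Polynomial.coeff g i)"
    by simp
qed

text \<open>
  If \<open>g\<close> is orthogonal to \<open>J\<close>, then only the constant coefficient of the reduced product \<open>h\<close> of \<open>f\<close> and the flip of \<open>g\<close>
  is known to vanish. The coefficient of \<open>x\<^sup>k\<close> in \<open>h\<close> is the constant coefficient for \<open>x\<^sup>-\<^sup>k f\<close> in place of \<open>f\<close>, and
  \<open>J\<close> contains that element as well.
\<close>
lemma orthogonal_iff_annihilates:
  assumes J: "\<And>f h. cc_class n a f \<in> J \<Longrightarrow> cc_class n a (h * f) \<in> J"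
    and g: "Polynomial.degree g < n"
  shows "(\<forall>f. Polynomial.degree f < n \<longrightarrow> cc_class n a f \<in> J
      \<longrightarrow> (\<Sum>i<n. Polynomial.coeff f i * Polynomial.coeff g i) = 0)
    \<longleftrightarrow> (\<forall>f. cc_class n a f \<in> J \<longrightarrow> cc_cong n a (f * cc_flip n b g) 0)"
proof (intro iffI allI impI)
  fix f assume ann: "\<forall>f. cc_class n a f \<in> J \<longrightarrow> cc_cong n a (f * cc_flip n b g) 0"
    and f: "Polynomial.degree f < n" "cc_class n a f \<in> J"
  obtain r where r: "Polynomial.degree r < n" "cc_cong n a (f * cc_flip n b g) r"
    "Polynomial.coeff r 0 = (\<Sum>i<n. Polynomial.coeff f i * Polynomial.coeff g i)"
    using constant_coeff_mult_flip [OF f(1) g] by blast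
  have "cc_cong n a (f * cc_flip n b g) 0"
    using ann f(2) by blast
  with r(2) have "cc_cong n a r 0"
    using cc_cong_trans [OF cc_cong_sym] by blast
  then have "r = 0"
    by (rule cc_cong_unique) (use r(1) n_pos in simp_all)
  with r(3) show "(\<Sum>i<n. Polynomial.coeff f i * Polynomial.coeff g i) = 0"
    by simp
next
  fix f assume orth: "\<forall>f. Polynomial.degree f < n \<longrightarrow> cc_class n a f \<in> J
      \<longrightarrow> (\<Sum>i<n. Polynomial.coeff f i * Polynomial.coeff g i) = 0"
    and f: "cc_class n a f \<in> J"
  obtain h where h: "Polynomial.degree h < n" "cc_cong n a (f * cc_flip n b g) h"
    using cc_cong_reduce [OF n_pos] by blast
  have "Polynomial.coeff h k = 0" if k: "k < n" for k
  proof -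
    let ?x = "Polynomial.monom 1 k :: 'r poly"
    have deg: "Polynomial.degree ?x < n"
      using k by (simp add: degree_monom_eq)
    obtain f' where f': "Polynomial.degree f' < n" "cc_cong n a (cc_flip n b ?x * f) f'"
      using cc_cong_reduce [OF n_pos] by blast
    have "cc_class n a f' \<in> J"
      using J [OF f, of "cc_flip n b ?x"] f'(2) by (simp only: cc_class_eq_iff [symmetric])
    with orth f'(1) have orth': "(\<Sum>i<n. Polynomial.coeff f' i * Polynomial.coeff g i) = 0"
      by blast
    obtain r where r: "Polynomial.degree r < n" "cc_cong n a (f' * cc_flip n b g) r"
      "Polynomial.coeff r 0 = (\<Sum>i<n. Polynomial.coeff f' i * Polynomial.coeff g i)"
      using constant_coeff_mult_flip [OF f'(1) g] by blast
    obtain r' where r': "Polynomial.degree r' < n" "cc_cong n a (h * cc_flip n b ?x) r'"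
      "Polynomial.coeff r' 0 = (\<Sum>i<n. Polynomial.coeff h i * Polynomial.coeff ?x i)"
      using constant_coeff_mult_flip [OF h(1) deg] by blast
    \<comment> \<open>The reductions \<open>r\<close> and \<open>r'\<close> both represent \<open>x\<^sup>-\<^sup>k f(x) g(x\<^sup>-\<^sup>1)\<close>.\<close>
    have "cc_cong n a r (f' * cc_flip n b g)"
      by (rule cc_cong_sym [OF r(2)])
    also have "cc_cong n a \<dots> (cc_flip n b ?x * f * cc_flip n b g)"
      by (intro cc_cong_mult cc_cong_refl cc_cong_sym [OF f'(2)])
    also have "\<dots> = f * cc_flip n b g * cc_flip n b ?x"
      by (simp add: algebra_simps)
    also have "cc_cong n a \<dots> (h * cc_flip n b ?x)"
      by (intro cc_cong_mult cc_cong_refl h(2))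
    also note r'(2)
    finally have "r = r'"
      by (rule cc_cong_unique) (use r(1) r'(1) in simp_all)
    moreover have "(\<Sum>i<n. Polynomial.coeff h i * Polynomial.coeff ?x i)
        = (\<Sum>i<n. if i = k then Polynomial.coeff h i else 0)"
      by (intro sum.cong refl) auto
    then have "Polynomial.coeff r' 0 = Polynomial.coeff h k"
      using r'(3) k by simp
    ultimately show ?thesis
      using r(3) orth' by simp
  qed
  moreover have "Polynomial.coeff h k = 0" if "\<not> k < n" for k
    using that h(1) by (intro coeff_eq_0) simp
  ultimately have "h = 0"
    by (intro poly_eqI) auto
  with h(2) show "cc_cong n a (f * cc_flip n b g) 0"
    by simp
qed

text \<open>
  Words of length \<open>n\<close> are polynomials of degree below \<open>n\<close>; both sides say that the flip of \<open>d\<close> annihilates \<open>J\<close>.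
\<close>
lemma dual_code_eq:
  assumes ord: "a ^ e = 1" "0 < e"
    and carrier: "J \<subseteq> carrier (cc_ring n a)"
    and J: "\<And>f h. cc_class n a f \<in> J \<Longrightarrow> cc_class n a (h * f) \<in> J"
  shows "dual_code n (code_of n a J)
    = code_of n b (reciprocal_set n a b (annihilator (cc_ring n a) J))"
proof -
  have mem_recip: "cc_class n b g \<in> reciprocal_set n a b (annihilator (cc_ring n a) J)
      \<longleftrightarrow> (\<forall>f. cc_class n a f \<in> J \<longrightarrow> cc_cong n a (f * cc_flip n b g) 0)" for g
  proof -
    have "cc_class n b g \<in> reciprocal_set n a b (annihilator (cc_ring n a) J)
        \<longleftrightarrow> cc_class n a (cc_flip n b g) \<in> annihilator (cc_ring n a) J"
      using annihilator_closed [OF carrier] by (rule cc_class_mem_reciprocal_set [OF ord])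
    then show ?thesis
      unfolding cc_class_mem_annihilator [OF carrier] by (simp add: mult.commute)
  qed
  have deg: "Polynomial.degree (Poly c) < n" if "length c = n" for c :: "'r list"
  proof -
    have "Polynomial.degree (Poly c) \<le> n - 1"
      by (rule degree_le) (use that in \<open>auto simp: nth_default_def\<close>)
    then show ?thesis
      using n_pos by simp
  qed
  have word: "\<exists>c. length c = n \<and> Poly c = f" if f: "Polynomial.degree f < n" for f :: "'r poly"
  proof (intro exI conjI)
    show "Poly (map (Polynomial.coeff f) [0..<n]) = f"
      using f by (intro poly_eqI) (auto simp: nth_default_def intro!: coeff_eq_0)
  qed simp
  show ?thesis
  proof (intro Set.set_eqI)
    fix d
    have "d \<in> dual_code n (code_of n a J) \<longleftrightarrow> length d = n \<and>
      (\<forall>f. Polynomial.degree f < n \<longrightarrow> cc_class n a f \<in> J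
        \<longrightarrow> (\<Sum>i<n. Polynomial.coeff f i * Polynomial.coeff (Poly d) i) = 0)"
      (is "_ \<longleftrightarrow> _ \<and> ?orth")
    proof (cases "length d = n")
      case d: True
      have pairing: "(\<Sum>i<n. d ! i * c ! i)
          = (\<Sum>i<n. Polynomial.coeff (Poly c) i * Polynomial.coeff (Poly d) i)"
        if "length c = n" for c
        using that d by (intro sum.cong refl) (simp add: nth_default_nth mult.commute)
      have "(\<forall>c\<in>code_of n a J. (\<Sum>i<n. d ! i * c ! i) = 0) \<longleftrightarrow> ?orth"
      proof (intro iffI ballI allI impI)
        fix c assume orth: ?orth and "c \<in> code_of n a J"
        then have c: "length c = n" "cc_class n a (Poly c) \<in> J"
          by (simp_all add: code_of_def)
        show "(\<Sum>i<n. d ! i * c ! i) = 0"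
          unfolding pairing [OF c(1)] using orth deg [OF c(1)] c(2) by blast
      next
        fix f assume *: "\<forall>c\<in>code_of n a J. (\<Sum>i<n. d ! i * c ! i) = 0"
          "Polynomial.degree f < n" "cc_class n a f \<in> J"
        obtain c where c: "length c = n" "Poly c = f"
          using word *(2) by blast
        then have "c \<in> code_of n a J"
          using *(3) by (simp add: code_of_def)
        then show "(\<Sum>i<n. Polynomial.coeff f i * Polynomial.coeff (Poly d) i) = 0"
          using *(1) pairing [OF c(1)] c(2) by simp
      qed
      then show ?thesis
        using d by (simp add: dual_code_def)
    qed (simp add: dual_code_def)
    also have "\<dots> \<longleftrightarrow> d \<in> code_of n b (reciprocal_set n a b (annihilator (cc_ring n a) J))"
    proof (cases "length d = n")
      case d: True
      then show ?thesis
        using orthogonal_iff_annihilates [of J "Poly d", OF J deg [OF d]] mem_recip [of "Poly d"]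
        by (simp only: code_of_def mem_Collect_eq)
    qed (simp add: code_of_def)
    finally show "d \<in> dual_code n (code_of n a J)
      \<longleftrightarrow> d \<in> code_of n b (reciprocal_set n a b (annihilator (cc_ring n a) J))" .
  qed
qed

end

section \<open>The ring R[x]/(x^n - alpha) as a ring over F[x] + uF[x]\<close>

definition lift_poly :: "'a::comm_ring_1 poly \<Rightarrow> 'a ruv poly" where
  "lift_poly f = map_poly emb f"

lemma coeff_lift_poly: "Polynomial.coeff (lift_poly f) i = emb (Polynomial.coeff f i)"
  by (simp add: lift_poly_def coeff_map_poly emb_hom)

lemma emb_diff: "emb (x - y) = emb x - emb y"
  by (simp add: emb_def minus_ruv_def)

lemma emb_sum: "emb (\<Sum>i\<in>A. f i) = (\<Sum>i\<in>A. emb (f i))"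
  by (induction A rule: infinite_finite_induct) (simp_all add: emb_hom)

lemma emb_power: "emb (x ^ k) = emb x ^ k"
  by (induction k) (simp_all add: emb_hom)

lemma lift_poly_0 [simp]: "lift_poly 0 = 0"
  by (simp add: lift_poly_def)

lemma lift_poly_1 [simp]: "lift_poly 1 = 1"
  by (simp add: lift_poly_def emb_hom)

lemma lift_poly_pCons [simp]: "lift_poly (pCons c f) = pCons (emb c) (lift_poly f)"
  by (simp add: lift_poly_def map_poly_pCons emb_hom)

lemma lift_poly_monom: "lift_poly (Polynomial.monom c k) = Polynomial.monom (emb c) k"
  by (simp add: lift_poly_def map_poly_monom emb_hom)

lemma lift_poly_add: "lift_poly (f + g) = lift_poly f + lift_poly g"
  by (intro poly_eqI) (simp add: coeff_lift_poly emb_hom)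

lemma lift_poly_diff: "lift_poly (f - g) = lift_poly f - lift_poly g"
  by (intro poly_eqI) (simp add: coeff_lift_poly emb_diff)

lemma lift_poly_mult: "lift_poly (f * g) = lift_poly f * lift_poly g"
  by (intro poly_eqI) (simp add: coeff_lift_poly coeff_mult emb_sum emb_hom)

lemma lift_poly_power: "lift_poly (f ^ k) = lift_poly f ^ k"
  by (induction k) (simp_all add: lift_poly_mult)

lemma ruv_expand:
  "x = emb (coeff_1 x) + ru * emb (coeff_u x) + rv * emb (coeff_v x) + ru * rv * emb (coeff_uv x)"
  using Ruv_eq [of "coeff_1 x" "coeff_u x" "coeff_v x" "coeff_uv x"] by (simp add: mult.commute)

lemma ruv_poly_decomp:
  obtains f0 f1 f2 f3 where
    "f = lift_poly f0 + [:ru:] * lift_poly f1 + [:rv:] * lift_poly f2 + [:ru:] * [:rv:] * lift_poly f3"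
proof
  show "f = lift_poly (map_poly coeff_1 f) + [:ru:] * lift_poly (map_poly coeff_u f)
    + [:rv:] * lift_poly (map_poly coeff_v f) + [:ru:] * [:rv:] * lift_poly (map_poly coeff_uv f)"
  proof (rule poly_eqI)
    have "coeff_1 (0 :: 'a ruv) = 0" "coeff_u (0 :: 'a ruv) = 0" "coeff_v (0 :: 'a ruv) = 0"
      "coeff_uv (0 :: 'a ruv) = 0"
      by (simp_all add: zero_ruv_def)
    then show "Polynomial.coeff f i = Polynomial.coeff (lift_poly (map_poly coeff_1 f)
        + [:ru:] * lift_poly (map_poly coeff_u f) + [:rv:] * lift_poly (map_poly coeff_v f)
        + [:ru:] * [:rv:] * lift_poly (map_poly coeff_uv f)) i" for i
      using ruv_expand [of "Polynomial.coeff f i"] by (simp add: coeff_lift_poly coeff_map_poly mult.commute [of rv ru])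
  qed
qed

lemma ruv_poly_decomp_zero:
  assumes "lift_poly a + [:ru:] * lift_poly b + [:rv:] * lift_poly c + [:ru:] * [:rv:] * lift_poly d = 0"
  shows "a = 0" "b = 0" "c = 0" "d = 0"
proof -
  have "Ruv (Polynomial.coeff a i) (Polynomial.coeff b i) (Polynomial.coeff c i) (Polynomial.coeff d i) = 0" for i
    using arg_cong [OF assms, of "\<lambda>f. Polynomial.coeff f i"]
    by (simp add: coeff_lift_poly Ruv_eq mult.commute)
  then show "a = 0" "b = 0" "c = 0" "d = 0"
    by (auto intro!: poly_eqI simp: zero_ruv_def)
qed

text \<open>
  Over \<open>F[x]\<close> the modulus is \<open>w\<^sup>q\<close> minus an element of the ideal \<open>\<langle>v\<rangle>\<close>.
  In the application \<open>w\<close> is \<open>x\<^sup>3 - \<alpha>\<^sub>0\<close>.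
\<close>
locale uv_chain =
  fixes n q :: nat and \<alpha>1 \<alpha>3 \<alpha>4 :: "'a::field" and w :: "'a poly"
  assumes \<alpha>3_nonzero: "\<alpha>3 \<noteq> 0"
    and w_nonzero: "w \<noteq> 0"
    and w_power: "w ^ q = Polynomial.monom 1 n - [:\<alpha>1:]"
begin

definition \<alpha> :: "'a ruv" where
  "\<alpha> = emb \<alpha>1 + emb \<alpha>3 * rv + emb \<alpha>4 * (ru * rv)"

abbreviation cong (infix "\<equiv>\<^sub>\<alpha>" 50) where
  "f \<equiv>\<^sub>\<alpha> g \<equiv> cc_cong n \<alpha> f g"

lemma modulus_eq:
  "Polynomial.monom 1 n - [:\<alpha>:]
    = lift_poly (w ^ q) - [:rv:] * lift_poly [:\<alpha>3:] - [:ru:] * [:rv:] * lift_poly [:\<alpha>4:]"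
proof -
  have "lift_poly (w ^ q) = Polynomial.monom 1 n - [:emb \<alpha>1:]"
    by (simp add: w_power lift_poly_diff lift_poly_monom emb_hom)
  moreover have "[:\<alpha>:] = [:emb \<alpha>1:] + [:rv:] * lift_poly [:\<alpha>3:] + [:ru:] * [:rv:] * lift_poly [:\<alpha>4:]"
    by (simp add: \<alpha>_def mult.commute)
  ultimately show ?thesis
    by (simp only: diff_diff_eq add.assoc)
qed

lemma w_power_cong: 
  "lift_poly (w ^ q) \<equiv>\<^sub>\<alpha> [:rv:] * (lift_poly [:\<alpha>3:] + [:ru:] * lift_poly [:\<alpha>4:])"
proof -
  have "lift_poly (w ^ q) - [:rv:] * (lift_poly [:\<alpha>3:] + [:ru:] * lift_poly [:\<alpha>4:])
      = Polynomial.monom 1 n - [:\<alpha>:]"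
    unfolding modulus_eq by (simp only: algebra_simps)
  then show ?thesis
    by (simp add: cc_cong_def)
qed

lemma UV_squares: "[:ru:] * [:ru:] = (0 :: 'a ruv poly)" "[:rv:] * [:rv:] = (0 :: 'a ruv poly)"
  by (simp_all add: ruv_relations)

text \<open>
  The square of \<open>w\<^sup>q\<close> has the factor \<open>v\<^sup>2 = 0\<close>.
\<close>
lemma w_power_zero: "lift_poly (w ^ (2 * q)) \<equiv>\<^sub>\<alpha> 0"
proof -
  let ?r = "lift_poly [:\<alpha>3:] + [:ru:] * lift_poly [:\<alpha>4:]"
  have "lift_poly (w ^ q) * lift_poly (w ^ q) \<equiv>\<^sub>\<alpha> [:rv:] * ?r * ([:rv:] * ?r)"
    by (intro cc_cong_mult w_power_cong)
  also have "[:rv:] * ?r * ([:rv:] * ?r) = [:rv:] * [:rv:] * (?r * ?r)"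
    by (simp only: mult_ac)
  also have "\<dots> = 0"
    by (simp only: UV_squares mult_zero_left)
  finally show ?thesis
    by (simp only: lift_poly_mult [symmetric] power_add [symmetric] mult_2 [symmetric])
qed

lemma w_power_ge_zero: "2 * q \<le> k \<Longrightarrow> lift_poly (w ^ k) \<equiv>\<^sub>\<alpha> 0"
  using cc_cong_mult [OF w_power_zero cc_cong_refl [of n \<alpha> "lift_poly (w ^ (k - 2 * q))"]]
  by (simp only: lift_poly_mult [symmetric] power_add [symmetric] le_add_diff_inverse mult_zero_left)

text \<open>
  Write \<open>u c\<close> as a multiple of the modulus and compare the components at \<open>1, u, v, uv\<close>. The \<open>u\<close> component says
  \<open>c = w\<^sup>q g\<^sub>1\<close>, and the \<open>v\<close> and \<open>uv\<close> components can be solved for \<open>\<alpha>\<^sub>3 g\<^sub>0\<close> and \<open>\<alpha>\<^sub>3 g\<^sub>1\<close>, which makes \<open>g\<^sub>1\<close> divisible by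
  another factor \<open>w\<^sup>q\<close>.
\<close>
lemma u_lift_cong_zero:
  assumes "[:ru:] * lift_poly c \<equiv>\<^sub>\<alpha> 0"
  shows "w ^ (2 * q) dvd c"
proof -
  obtain g where "[:ru:] * lift_poly c = (Polynomial.monom 1 n - [:\<alpha>:]) * g"
    using assms by (auto simp: cc_cong_def dvd_def)
  moreover obtain g0 g1 g2 g3 where
    "g = lift_poly g0 + [:ru:] * lift_poly g1 + [:rv:] * lift_poly g2 + [:ru:] * [:rv:] * lift_poly g3"
    by (rule ruv_poly_decomp)
  moreover have "(W - V * a3 - U * V * a4) * (G0 + U * G1 + V * G2 + U * V * G3)
      = W * G0 + U * (W * G1) + V * (W * G2 - a3 * G0) + U * V * (W * G3 - a3 * G1 - a4 * G0)"
    if "U * U = 0" "V * V = 0" for U V W a3 a4 G0 G1 G2 G3 :: "'a ruv poly"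
    proof -
      have "(W - V * a3 - U * V * a4) * (G0 + U * G1 + V * G2 + U * V * G3)
          = W * G0 + U * (W * G1) + V * (W * G2 - a3 * G0) + U * V * (W * G3 - a3 * G1 - a4 * G0)
            - U * U * (V * a4 * G1 + V * V * a4 * G3) - V * V * (a3 * G2 + U * a3 * G3 + U * a4 * G2)"
        by (simp add: algebra_simps)
      then show ?thesis
        using that by simp
    qed
  note this [OF UV_squares]
  ultimately have c_eq: "[:ru:] * lift_poly c
      = lift_poly (w ^ q * g0) + [:ru:] * lift_poly (w ^ q * g1)
      + [:rv:] * lift_poly (w ^ q * g2 - [:\<alpha>3:] * g0)
      + [:ru:] * [:rv:] * lift_poly (w ^ q * g3 - [:\<alpha>3:] * g1 - [:\<alpha>4:] * g0)"
    unfolding modulus_eq by (simp only: lift_poly_mult lift_poly_diff)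
  have "lift_poly (w ^ q * g0) + [:ru:] * lift_poly (w ^ q * g1 - c)
      + [:rv:] * lift_poly (w ^ q * g2 - [:\<alpha>3:] * g0)
      + [:ru:] * [:rv:] * lift_poly (w ^ q * g3 - [:\<alpha>3:] * g1 - [:\<alpha>4:] * g0)
      = lift_poly (w ^ q * g0) + [:ru:] * lift_poly (w ^ q * g1)
      + [:rv:] * lift_poly (w ^ q * g2 - [:\<alpha>3:] * g0)
      + [:ru:] * [:rv:] * lift_poly (w ^ q * g3 - [:\<alpha>3:] * g1 - [:\<alpha>4:] * g0) - [:ru:] * lift_poly c"
    by (simp only: lift_poly_diff [of "w ^ q * g1" c] right_diff_distrib diff_add_eq add_diff_eq)
  also have "\<dots> = 0"
    by (simp only: c_eq diff_self)
  finally have zero: "lift_poly (w ^ q * g0) + [:ru:] * lift_poly (w ^ q * g1 - c)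
      + [:rv:] * lift_poly (w ^ q * g2 - [:\<alpha>3:] * g0)
      + [:ru:] * [:rv:] * lift_poly (w ^ q * g3 - [:\<alpha>3:] * g1 - [:\<alpha>4:] * g0) = 0" .
  have solve: "y = x - z" if "x - y - z = 0" for x y z :: "'a poly"
    using that by (simp add: algebra_simps)
  note zeros = ruv_poly_decomp_zero [OF zero]
  have c: "c = w ^ q * g1" and g0: "[:\<alpha>3:] * g0 = w ^ q * g2"
    and g1: "[:\<alpha>3:] * g1 = w ^ q * g3 - [:\<alpha>4:] * g0"
    using zeros(2,3) solve [OF zeros(4)] by (simp_all only: right_minus_eq)
  have cancel: "w ^ q dvd g" if "w ^ q dvd [:\<alpha>3:] * g" for g
    using that \<alpha>3_nonzero by (simp add: dvd_smult_iff)
  have "w ^ q dvd g0"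
    by (rule cancel) (simp only: g0 dvd_triv_left)
  then have "w ^ q dvd g1"
    by - (rule cancel, simp only: g1, intro dvd_diff dvd_mult dvd_triv_left)
  then show ?thesis
    unfolding c mult_2 power_add by (intro mult_dvd_mono dvd_refl)
qed

text \<open>
  Multiplying \<open>w\<^sup>q = v (\<alpha>\<^sub>3 + \<alpha>\<^sub>4 u)\<close> by the inverse of \<open>\<alpha>\<^sub>3 + \<alpha>\<^sub>4 u\<close> expresses \<open>v\<close> through \<open>u\<close> and \<open>w\<^sup>q\<close>, which eliminates
  the \<open>v\<close> and \<open>uv\<close> components.
\<close>
lemma cong_lift_decomp: obtains A B where "f \<equiv>\<^sub>\<alpha> lift_poly A + [:ru:] * lift_poly B"
proof -
  obtain f0 f1 f2 f3 where f:
    "f = lift_poly f0 + [:ru:] * lift_poly f1 + [:rv:] * lift_poly f2 + [:ru:] * [:rv:] * lift_poly f3"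
    by (rule ruv_poly_decomp)
  let ?i = "inverse \<alpha>3"
  \<comment> \<open>The inverse of \<open>\<alpha>\<^sub>3 + \<alpha>\<^sub>4 u\<close>, by the geometric series with \<open>u\<^sup>2 = 0\<close>.\<close>
  let ?s = "lift_poly [:?i:] - [:ru:] * lift_poly [:\<alpha>4 * ?i * ?i:]"
  have inv: "lift_poly [:\<alpha>3:] * lift_poly [:?i:] = 1"
    using \<alpha>3_nonzero by (simp add: one_pCons flip: emb_hom)
  have quot: "lift_poly [:\<alpha>4 * ?i * ?i:] = lift_poly [:\<alpha>4:] * lift_poly [:?i:] * lift_poly [:?i:]"
    by (simp add: emb_hom mult_ac)
  have unit: "V * (a3 + U * a4) * (i - U * (a4 * i * i)) = V"
    if "U * U = 0" "a3 * i = 1" for U V a3 a4 i :: "'a ruv poly"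
    proof -
      have "V * (a3 + U * a4) * (i - U * (a4 * i * i))
          = V * (a3 * i) + U * V * a4 * i * (1 - a3 * i) - U * U * (V * a4 * a4 * i * i)"
        by (simp add: algebra_simps)
      then show ?thesis
        using that by simp
    qed
  have "lift_poly (w ^ q) * ?s \<equiv>\<^sub>\<alpha> [:rv:] * (lift_poly [:\<alpha>3:] + [:ru:] * lift_poly [:\<alpha>4:]) * ?s"
    by (intro cc_cong_mult w_power_cong cc_cong_refl)
  then have "lift_poly (w ^ q) * ?s \<equiv>\<^sub>\<alpha> [:rv:]"
    unfolding quot unit [OF UV_squares(1) inv] .
  then have "lift_poly f0 + [:ru:] * lift_poly f1 + [:rv:] * (lift_poly f2 + [:ru:] * lift_poly f3)
      \<equiv>\<^sub>\<alpha> lift_poly f0 + [:ru:] * lift_poly f1 + lift_poly (w ^ q) * ?s * (lift_poly f2 + [:ru:] * lift_poly f3)"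
    by (intro cc_cong_add cc_cong_mult cc_cong_refl) (rule cc_cong_sym)
  also have "\<dots> = lift_poly (f0 + w ^ q * [:?i:] * f2)
      + [:ru:] * lift_poly (f1 + w ^ q * [:?i:] * f3 - w ^ q * [:\<alpha>4 * ?i * ?i:] * f2)"
  proof -
    have "F0 + U * F1 + W * (i - U * k) * (F2 + U * F3)
        = (F0 + W * i * F2) + U * (F1 + W * i * F3 - W * k * F2)"
      if "U * U = 0" for U F0 F1 W i k F2 F3 :: "'a ruv poly"
      proof -
      have "F0 + U * F1 + W * (i - U * k) * (F2 + U * F3)
          = (F0 + W * i * F2) + U * (F1 + W * i * F3 - W * k * F2) - U * U * (W * k * F3)"
        by (simp add: algebra_simps)
      then show ?thesis
        using that by simp
    qed
    from this [OF UV_squares(1)] show ?thesis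
      by (simp only: lift_poly_add lift_poly_diff lift_poly_mult)
  qed
  also have "lift_poly f0 + [:ru:] * lift_poly f1 + [:rv:] * (lift_poly f2 + [:ru:] * lift_poly f3) = f"
    by (simp add: f smult_add_right mult.commute [of rv])
  finally show ?thesis
    by (rule that)
qed

lemma dvd_cancel_power:
  assumes "w ^ (2 * q) dvd A * w ^ k" "k \<le> 2 * q"
  shows "w ^ (2 * q - k) dvd A"
proof -
  have "w ^ (2 * q - k) * w ^ k dvd A * w ^ k"
    using assms by (simp add: power_add [symmetric])
  then show ?thesis
    using w_nonzero by simp
qed

text \<open>
  Let \<open>f = A + u B\<close> annihilate both generators. Annihilating \<open>u w\<^sup>\<mu>\<close> makes \<open>A\<close> a multiple of \<open>w\<^sup>2\<^sup>q\<^sup>-\<^sup>\<mu>\<close>; subtracting the same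
  multiple of the first generator on the right leaves an element \<open>u C\<close>, and annihilating \<open>w\<^sup>l + u a\<close> makes \<open>C\<close> a
  multiple of \<open>w\<^sup>2\<^sup>q\<^sup>-\<^sup>l\<close>. In the other direction the assumption on \<open>b\<close> is exactly that the product of the two first
  generators vanishes; the power \<open>w\<close> to the \<open>2q + l - \<mu>\<close> in it is zero because of \<open>\<mu> \<le> l\<close>.
\<close>
lemma annihilator_generators:
  fixes a b :: "'a ruv poly"
  assumes le: "\<mu> \<le> l" "l \<le> 2 * q"
    and cross: "[:ru:] * (lift_poly (w ^ l) * b + a * lift_poly (w ^ (2 * q - \<mu>))) \<equiv>\<^sub>\<alpha> 0"
  shows "f * (lift_poly (w ^ l) + [:ru:] * a) \<equiv>\<^sub>\<alpha> 0 \<and> f * ([:ru:] * lift_poly (w ^ \<mu>)) \<equiv>\<^sub>\<alpha> 0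
    \<longleftrightarrow> (\<exists>c d. f \<equiv>\<^sub>\<alpha> c * (lift_poly (w ^ (2 * q - \<mu>)) + [:ru:] * b)
                    + d * ([:ru:] * lift_poly (w ^ (2 * q - l))))"
    (is "f * ?f1 \<equiv>\<^sub>\<alpha> 0 \<and> f * ?f2 \<equiv>\<^sub>\<alpha> 0 \<longleftrightarrow> (\<exists>c d. f \<equiv>\<^sub>\<alpha> c * ?g1 + d * ?g2)")
proof -
  note UU = UV_squares(1)
  have ideal: "h * x \<equiv>\<^sub>\<alpha> 0" if "x \<equiv>\<^sub>\<alpha> 0" for h x
    using cc_cong_mult [OF cc_cong_refl [of n \<alpha> h] that] by simp
  have add: "x + y \<equiv>\<^sub>\<alpha> 0" if "x \<equiv>\<^sub>\<alpha> 0" "y \<equiv>\<^sub>\<alpha> 0" for x y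
    using cc_cong_add [OF that] by simp
  have W: "lift_poly (w ^ i) * lift_poly (w ^ j) \<equiv>\<^sub>\<alpha> 0" if "2 * q \<le> i + j" for i j
    using w_power_ge_zero [OF that] by (simp add: lift_poly_mult power_add)
  have g1f1: "?g1 * ?f1 \<equiv>\<^sub>\<alpha> 0"
  proof -
    have "(G + U * b) * (F + U * a) = G * F + U * (F * b + a * G)"
      if "U * U = 0" for U F G :: "'a ruv poly"
      proof -
      have "(G + U * b) * (F + U * a) = G * F + U * (F * b + a * G) + U * U * (a * b)"
        by (simp add: algebra_simps)
      then show ?thesis
        using that by simp
    qed
    note eq = this [OF UU]
    show ?thesis
      unfolding eq using le by (intro add W cross) simp
  qed
  have g1f2: "?g1 * ?f2 \<equiv>\<^sub>\<alpha> 0"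
  proof -
    have "(G + U * b) * (U * F) = U * (G * F)"
      if "U * U = 0" for U F G :: "'a ruv poly"
      proof -
      have "(G + U * b) * (U * F) = U * (G * F) + U * U * (b * F)"
        by (simp add: algebra_simps)
      then show ?thesis
        using that by simp
    qed
    note eq = this [OF UU]
    show ?thesis
      unfolding eq using le by (intro ideal W) simp
  qed
  have g2f1: "?g2 * ?f1 \<equiv>\<^sub>\<alpha> 0"
  proof -
    have "(U * G) * (F + U * a) = U * (G * F)"
      if "U * U = 0" for U F G :: "'a ruv poly"
      proof -
      have "(U * G) * (F + U * a) = U * (G * F) + U * U * (G * a)"
        by (simp add: algebra_simps)
      then show ?thesis
        using that by simp
    qed
    note eq = this [OF UU]
    show ?thesis
      unfolding eq using le by (intro ideal W) simp
  qed
  have g2f2: "?g2 * ?f2 \<equiv>\<^sub>\<alpha> 0"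
  proof -
    have "(U * G) * (U * F) = 0" if "U * U = 0" for U F G :: "'a ruv poly"
      proof -
      have "(U * G) * (U * F) = U * U * (G * F)"
        by (simp add: algebra_simps)
      then show ?thesis
        using that by simp
    qed
    from this [OF UU] show ?thesis by simp
  qed
  show ?thesis
  proof
    assume "\<exists>c d. f \<equiv>\<^sub>\<alpha> c * ?g1 + d * ?g2"
    then obtain c d where f: "f \<equiv>\<^sub>\<alpha> c * ?g1 + d * ?g2" by blast
    have "f * h \<equiv>\<^sub>\<alpha> 0" if "?g1 * h \<equiv>\<^sub>\<alpha> 0" "?g2 * h \<equiv>\<^sub>\<alpha> 0" for h
    proof -
      have "f * h \<equiv>\<^sub>\<alpha> (c * ?g1 + d * ?g2) * h"
        by (intro cc_cong_mult f cc_cong_refl)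
      also have "(c * ?g1 + d * ?g2) * h = c * (?g1 * h) + d * (?g2 * h)"
        by (simp only: distrib_right mult.assoc)
      also have "\<dots> \<equiv>\<^sub>\<alpha> 0"
        by (intro add ideal that)
      finally show ?thesis .
    qed
    then show "f * ?f1 \<equiv>\<^sub>\<alpha> 0 \<and> f * ?f2 \<equiv>\<^sub>\<alpha> 0"
      using g1f1 g1f2 g2f1 g2f2 by blast
  next
    assume f: "f * ?f1 \<equiv>\<^sub>\<alpha> 0 \<and> f * ?f2 \<equiv>\<^sub>\<alpha> 0"
    obtain A B where AB: "f \<equiv>\<^sub>\<alpha> lift_poly A + [:ru:] * lift_poly B"
      by (rule cong_lift_decomp)
    have "[:ru:] * lift_poly (A * w ^ \<mu>) = (lift_poly A + [:ru:] * lift_poly B) * ?f2"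
    proof -
      have "U * (LA * F) = (LA + U * LB) * (U * F)" if "U * U = 0" for U LA LB F :: "'a ruv poly"
        proof -
      have "(LA + U * LB) * (U * F) = U * (LA * F) + U * U * (LB * F)"
        by (simp add: algebra_simps)
      then show ?thesis
        using that by simp
    qed
      from this [OF UU] show ?thesis by (simp only: lift_poly_mult)
    qed
    also have "\<dots> \<equiv>\<^sub>\<alpha> f * ?f2"
      by (intro cc_cong_mult cc_cong_sym [OF AB] cc_cong_refl)
    also have "f * ?f2 \<equiv>\<^sub>\<alpha> 0"
      using f by blast
    finally have "w ^ (2 * q - \<mu>) dvd A"
      using le by (intro dvd_cancel_power u_lift_cong_zero) simp_all
    then obtain A' where A': "A = w ^ (2 * q - \<mu>) * A'"
      by (auto simp: dvd_def)
    obtain C D where CD: "lift_poly B - lift_poly A' * b \<equiv>\<^sub>\<alpha> lift_poly C + [:ru:] * lift_poly D"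
      by (rule cong_lift_decomp)
    have "lift_poly A + [:ru:] * lift_poly B
        = lift_poly A' * ?g1 + [:ru:] * (lift_poly B - lift_poly A' * b)"
      by (simp only: A' lift_poly_mult algebra_simps)
    also have "\<dots> \<equiv>\<^sub>\<alpha> lift_poly A' * ?g1 + [:ru:] * (lift_poly C + [:ru:] * lift_poly D)"
      by (intro cc_cong_add cc_cong_mult cc_cong_refl CD)
    also have "[:ru:] * (lift_poly C + [:ru:] * lift_poly D) = [:ru:] * lift_poly C"
      by (simp only: distrib_left mult.assoc [symmetric] UU mult_zero_left add_0_right)
    finally have fC: "f \<equiv>\<^sub>\<alpha> lift_poly A' * ?g1 + [:ru:] * lift_poly C"
      by (rule cc_cong_trans [OF AB])
    have "[:ru:] * lift_poly (C * w ^ l)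
        = (lift_poly A' * ?g1 + [:ru:] * lift_poly C) * ?f1 - lift_poly A' * (?g1 * ?f1)"
    proof -
      have "U * (LC * F) = (x * g + U * LC) * (F + U * a) - x * (g * (F + U * a))"
        if "U * U = 0" for U LC x g F :: "'a ruv poly"
        proof -
      have "(x * g + U * LC) * (F + U * a) - x * (g * (F + U * a)) = U * (LC * F) + U * U * (LC * a)"
        by (simp add: algebra_simps)
      then show ?thesis
        using that by simp
    qed
      from this [OF UU] show ?thesis by (simp only: lift_poly_mult)
    qed
    also have "\<dots> \<equiv>\<^sub>\<alpha> f * ?f1 - lift_poly A' * (?g1 * ?f1)"
      by (intro cc_cong_diff cc_cong_mult cc_cong_sym [OF fC] cc_cong_refl)
    also have "\<dots> \<equiv>\<^sub>\<alpha> 0 - 0"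
      by (rule cc_cong_diff [OF conjunct1 [OF f] ideal [OF g1f1]])
    finally have "w ^ (2 * q - l) dvd C"
      using le by (intro dvd_cancel_power u_lift_cong_zero) simp_all
    then obtain C' where C': "C = w ^ (2 * q - l) * C'"
      by (auto simp: dvd_def)
    have "[:ru:] * lift_poly C = lift_poly C' * ?g2"
      by (simp only: C' lift_poly_mult mult_ac)
    with fC have "f \<equiv>\<^sub>\<alpha> lift_poly A' * ?g1 + lift_poly C' * ?g2"
      by (simp only:)
    then show "\<exists>c d. f \<equiv>\<^sub>\<alpha> c * ?g1 + d * ?g2"
      by blast
  qed
qed

end

section \<open>Inversion of x on ideals and on powers of x^3 - c\<close>

text \<open>
  The flip is an isomorphism, so it maps the ideal generated by \<open>g1\<close> and \<open>g2\<close> to the one generated by their flips;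
  the units \<open>U1\<close> and \<open>U2\<close> allow generators that are cleared of negative powers of \<open>x\<close>.
\<close>
lemma (in reciprocal_pair) genideal_pair_eq_of_flip:
  assumes G1: "cc_cong n b G1 (U1 * cc_flip n a g1)" and U1: "cc_cong n b (U1 * V1) 1"
    and G2: "cc_cong n b G2 (U2 * cc_flip n a g2)" and U2: "cc_cong n b (U2 * V2) 1"
  shows "genideal (cc_ring n b) {cc_class n b G1, cc_class n b G2}
    = {cc_class n b g | g. \<exists>c d. cc_cong n a (cc_flip n b g) (c * g1 + d * g2)}"
proof -
  interpret S: reciprocal_pair n b a by (rule swap)
  have invert: "cc_cong n b (cc_flip n a g) (V * G)"
    if "cc_cong n b G (U * cc_flip n a g)" "cc_cong n b (U * V) 1" for G U V g
  proof -
    have "cc_cong n b (V * G) (V * (U * cc_flip n a g))"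
      by (intro cc_cong_mult cc_cong_refl that(1))
    also have "V * (U * cc_flip n a g) = U * V * cc_flip n a g"
      by (simp only: mult_ac)
    also have "cc_cong n b \<dots> (1 * cc_flip n a g)"
      by (intro cc_cong_mult cc_cong_refl that(2))
    finally show ?thesis
      unfolding mult_1_left by (rule cc_cong_sym)
  qed
  have to_flip: "\<exists>c d. cc_cong n a (cc_flip n b g) (c * g1 + d * g2)"
    if "cc_cong n b g (c' * G1 + d' * G2)" for g c' d'
  proof -
    have "cc_cong n b g (c' * (U1 * cc_flip n a g1) + d' * (U2 * cc_flip n a g2))"
      using that by (rule cc_cong_trans) (intro cc_cong_add cc_cong_mult cc_cong_refl G1 G2)
    from S.cc_flip_cong [OF this]
    have "cc_cong n a (cc_flip n b g)
        (cc_flip n b (c' * U1) * cc_flip n b (cc_flip n a g1)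
          + cc_flip n b (d' * U2) * cc_flip n b (cc_flip n a g2))"
      by (simp only: cc_flip_simps mult.assoc)
    also have "cc_cong n a \<dots> (cc_flip n b (c' * U1) * g1 + cc_flip n b (d' * U2) * g2)"
      by (intro cc_cong_add cc_cong_mult cc_cong_refl cc_flip_flip)
    finally show ?thesis by blast
  qed
  have of_flip: "\<exists>c d. cc_cong n b g (c * G1 + d * G2)"
    if "cc_cong n a (cc_flip n b g) (c' * g1 + d' * g2)" for g c' d'
  proof -
    have "cc_cong n b g (cc_flip n a (cc_flip n b g))"
      by (rule cc_cong_sym [OF S.cc_flip_flip])
    also have "cc_cong n b \<dots> (cc_flip n a (c' * g1 + d' * g2))"
      by (rule cc_flip_cong [OF that])
    also have "cc_flip n a (c' * g1 + d' * g2)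
        = cc_flip n a c' * cc_flip n a g1 + cc_flip n a d' * cc_flip n a g2"
      by (simp only: cc_flip_simps)
    also have "cc_cong n b \<dots> (cc_flip n a c' * (V1 * G1) + cc_flip n a d' * (V2 * G2))"
      by (intro cc_cong_add cc_cong_mult cc_cong_refl invert [OF G1 U1] invert [OF G2 U2])
    finally have "cc_cong n b g (cc_flip n a c' * V1 * G1 + cc_flip n a d' * V2 * G2)"
      by (simp only: mult.assoc)
    then show ?thesis by blast
  qed
  have "(\<exists>c d. cc_cong n b g (c * G1 + d * G2))
      \<longleftrightarrow> (\<exists>c d. cc_cong n a (cc_flip n b g) (c * g1 + d * g2))" for g
    using to_flip [of g] of_flip [of g] by blast
  then have "{cc_class n b g | g. \<exists>c d. cc_cong n a (cc_flip n b g) (c * g1 + d * g2)}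
      = {cc_class n b g | g. \<exists>c d. cc_cong n b g (c * G1 + d * G2)}"
    by simp
  also have "\<dots> = {cc_class n b (c * G1 + d * G2) | c d. True}"
    unfolding cc_class_eq_iff [symmetric] by blast
  finally show ?thesis
    unfolding genideal_pair by simp
qed

lemma cubic_eq_lift: "cubic c = lift_poly (Polynomial.monom 1 3 - [:c:])"
  by (simp add: cubic_def lift_poly_diff lift_poly_monom emb_hom)

context
  fixes n :: nat and a b :: "'a::field ruv"
  assumes "reciprocal_pair n a b"
begin

interpretation reciprocal_pair n a b by fact
interpretation S: reciprocal_pair n b a by (rule swap)

text \<open>
  This is \<open>x\<^sup>3 (x\<^sup>-\<^sup>3 - c) = 1 - c x\<^sup>3 = - c (x\<^sup>3 - c\<^sup>-\<^sup>1)\<close>, raised to the power \<open>k\<close>.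
\<close>
lemma flip_cubic_power:
  assumes "c \<noteq> 0"
  shows "cc_cong n b (Polynomial.monom 1 (3 * k) * cc_flip n a (cubic c ^ k))
    (smult (emb ((- c) ^ k)) (cubic (inverse c) ^ k))"
proof -
  let ?y = "Polynomial.monom a (n - 1)"
  have "cc_cong n b (Polynomial.monom 1 3 * ?y ^ 3 - Polynomial.monom 1 3 * [:emb c:])
      (1 - Polynomial.monom 1 3 * [:emb c:])"
    by (intro cc_cong_diff cc_cong_refl S.X_inverse_power)
  moreover have "Polynomial.monom 1 3 * ?y ^ 3 - Polynomial.monom 1 3 * [:emb c:]
      = Polynomial.monom 1 3 * cc_flip n a (cubic c)"
    by (simp only: cubic_def cc_flip_simps cc_flip_monom smult_1_left right_diff_distrib)
  moreover have "1 - Polynomial.monom 1 3 * [:emb c:] = smult (emb (- c)) (cubic (inverse c))"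
  proof -
    have "emb (- c) * emb (inverse c) = - 1"
      using assms by (simp add: emb_def times_ruv_def one_ruv_def uminus_ruv_def)
    moreover have "emb (- c) = - emb c"
      by (simp add: emb_def uminus_ruv_def)
    ultimately show ?thesis
      by (simp add: cubic_def smult_diff_right smult_monom one_pCons flip: minus_monom)
  qed
  ultimately have "cc_cong n b (Polynomial.monom 1 3 * cc_flip n a (cubic c))
      (smult (emb (- c)) (cubic (inverse c)))"
    by simp
  from cc_cong_power [OF this, of k] show ?thesis
    by (simp add: power_mult_distrib monom_power cc_flip_power smult_power emb_power)
qed

lemma flip_quadratic:
  "cc_cong n b (Polynomial.monom 1 2 * cc_flip n a [:c2, c1, c0:]) [:c0, c1, c2:]"
proof -
  let ?x = "Polynomial.monom 1 1 :: 'a ruv poly" and ?y = "Polynomial.monom a (n - 1)"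
  have xy: "cc_cong n b (?x * ?y) 1"
    using S.X_inverse_power [of 1] by simp
  have "cc_cong n b (?x * ?x * [:c2:] + ?x * (?x * ?y) * [:c1:] + (?x * ?y) * (?x * ?y) * [:c0:])
      (?x * ?x * [:c2:] + ?x * 1 * [:c1:] + 1 * 1 * [:c0:])"
    by (intro cc_cong_add cc_cong_mult cc_cong_refl xy)
  moreover have "Polynomial.monom 1 2 * cc_flip n a [:c2, c1, c0:]
      = ?x * ?x * [:c2:] + ?x * (?x * ?y) * [:c1:] + (?x * ?y) * (?x * ?y) * [:c0:]"
  proof -
    have "Polynomial.monom 1 2 = ?x * ?x"
      by (simp add: mult_monom numeral_2_eq_2)
    moreover have "cc_flip n a [:c2, c1, c0:] = [:c2:] + ?y * ([:c1:] + ?y * [:c0:])"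
      by (simp only: cc_flip_def pcompose_pCons pcompose_0 mult_zero_right add_0_right)
    ultimately show ?thesis
      by (simp only: distrib_left mult_ac add_ac)
  qed
  moreover have "?x * ?x * [:c2:] + ?x * 1 * [:c1:] + 1 * 1 * [:c0:] = [:c0, c1, c2:]"
    by (simp add: monom_Suc monom_0)
  ultimately show ?thesis by simp
qed

text \<open>
  The common factor \<open>x\<^sup>N\<close> is distributed in each summand: \<open>x\<^sup>2\<close> reverses the quadratic coefficient, \<open>x\<^sup>3\<^sup>k\<close> clears the
  \<open>k\<close>-th power of the cubic, and \<open>x\<close> to the \<open>N - 3k - 2\<close> remains.
\<close>
lemma flip_quadratic_cubic_sum:
  assumes c: "c \<noteq> 0" and K: "\<And>k. k < K \<Longrightarrow> 3 * k + 2 \<le> N"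
  shows "cc_cong n b
    (Polynomial.monom 1 N * cc_flip n a (\<Sum>k<K. [:c2 k, c1 k, c0 k:] * cubic c ^ k))
    (\<Sum>k<K. [:c0 k, c1 k, c2 k:] * smult (emb ((- c) ^ k)) (cubic (inverse c) ^ k)
      * Polynomial.monom 1 (N - 3 * k - 2))"
proof -
  have "cc_cong n b
      (Polynomial.monom 1 N * (cc_flip n a [:c2 k, c1 k, c0 k:] * cc_flip n a (cubic c ^ k)))
      ([:c0 k, c1 k, c2 k:] * smult (emb ((- c) ^ k)) (cubic (inverse c) ^ k)
        * Polynomial.monom 1 (N - 3 * k - 2))" if "k < K" for k
  proof -
    have N: "2 + 3 * k + (N - 3 * k - 2) = N"
      using K [OF that] by simp
    have "Polynomial.monom 1 N = Polynomial.monom 1 2 * Polynomial.monom 1 (3 * k)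
        * Polynomial.monom (1 :: 'a ruv) (N - 3 * k - 2)"
      by (simp only: mult_monom mult_1_left N)
    then have "Polynomial.monom 1 N * (cc_flip n a [:c2 k, c1 k, c0 k:] * cc_flip n a (cubic c ^ k))
        = (Polynomial.monom 1 2 * cc_flip n a [:c2 k, c1 k, c0 k:])
          * (Polynomial.monom 1 (3 * k) * cc_flip n a (cubic c ^ k))
          * Polynomial.monom 1 (N - 3 * k - 2)"
      by (simp only: mult_ac)
    then show ?thesis
      by (simp only:) (intro cc_cong_mult cc_cong_refl flip_quadratic flip_cubic_power c)
  qed
  then show ?thesis
    unfolding cc_flip_sum cc_flip_simps sum_distrib_left by (intro cc_cong_sum) simp
qed

end

section \<open>Finite fields and units of finite order\<close>

text \<open>
  The translation by \<open>1\<close> permutes the ring, so it does not change the sum of all elements.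
\<close>
lemma CARD_of_nat_eq_0: "of_nat CARD('a::{ring_1,finite}) = (0 :: 'a)"
proof -
  have "(\<Sum>x\<in>UNIV. x + 1) = (\<Sum>x\<in>UNIV. x :: 'a)"
    by (rule sum.reindex_bij_witness [of _ "\<lambda>x. x - 1" "\<lambda>x. x + 1"]) auto
  then show ?thesis
    by (simp add: sum.distrib)
qed

lemma field_power_CARD:
  fixes x :: "'a::{field,finite}"
  shows "x ^ CARD('a) = x"
proof (cases "x = 0")
  case False
  let ?R = "ring_of_type_algebra :: 'a ring"
  interpret R: field ?R by (rule field_from_type_algebra)
  interpret G: group "Multiplicative_Group.mult_of ?R" by (rule R.field_mult_group)
  have pow: "x [^]\<^bsub>Multiplicative_Group.mult_of ?R\<^esub> k = x ^ k" for k :: nat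
    by (induction k) (simp_all add: ring_of_type_simps mult.commute)
  have "x [^]\<^bsub>Multiplicative_Group.mult_of ?R\<^esub> Coset.order (Multiplicative_Group.mult_of ?R) = 1"
    using False G.pow_order_eq_1 [of x] by (simp add: ring_of_type_simps)
  then have "x ^ (CARD('a) - 1) = 1"
    unfolding pow by (simp add: R.order_mult_of Coset.order_def ring_of_type_simps)
  then show ?thesis
    using power_minus_mult [of "CARD('a)" x] by simp
qed (simp add: zero_less_card_finite)

lemma prime_CHAR:
  assumes "prime p" "CARD('a::{field,finite}) = p ^ m"
  shows "CHAR('a) = p"
proof -
  have prime: "prime CHAR('a)"
    by (rule prime_CHAR_semidom) (rule finite_imp_CHAR_pos, simp)
  have "CHAR('a) dvd p ^ m"
    using of_nat_eq_0_iff_char_dvd [of "CARD('a)", where 'a = 'a] CARD_of_nat_eq_0 [where 'a = 'a]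
    unfolding assms(2) by blast
  with prime have "CHAR('a) dvd p"
    by (rule prime_dvd_power)
  with prime assms(1) show ?thesis
    by (simp add: primes_dvd_imp_eq)
qed

lemma monom_minus_const_power_char:
  fixes c :: "'a::{field,finite}"
  assumes "prime p" "CARD('a) = p ^ m"
  shows "(Polynomial.monom 1 k - [:c:]) ^ (p ^ s) = Polynomial.monom 1 (k * p ^ s) - [:c ^ (p ^ s):]"
proof -
  have char: "CHAR('a poly) = p"
    using prime_CHAR [OF assms] by simp
  have "((Polynomial.monom 1 k - [:c:]) + [:c:]) ^ (p ^ s)
      = (Polynomial.monom 1 k - [:c:]) ^ (p ^ s) + [:c:] ^ (p ^ s)"
    using assms(1) char by (intro freshmans_dream') simp_all
  then show ?thesis
    by (simp add: monom_power poly_const_pow algebra_simps)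
qed

lemma finite_UNIV_ruv: "finite (UNIV :: 'a::finite ruv set)"
proof (rule finite_surj)
  show "finite (UNIV :: ('a \<times> 'a \<times> 'a \<times> 'a) set)" by simp
  show "(UNIV :: 'a ruv set) \<subseteq> (\<lambda>(a, b, c, d). Ruv a b c d) ` UNIV"
  proof
    fix x :: "'a ruv"
    show "x \<in> (\<lambda>(a, b, c, d). Ruv a b c d) ` UNIV"
      by (rule image_eqI [of _ _ "(coeff_1 x, coeff_u x, coeff_v x, coeff_uv x)"]) simp_all
  qed
qed

text \<open>
  Two powers of \<open>x\<close> agree by the pigeonhole principle, and \<open>x\<close> can be cancelled.
\<close>
lemma unit_finite_order:
  fixes x y :: "'r::comm_ring_1"
  assumes "finite (UNIV :: 'r set)" "x * y = 1"
  obtains e where "0 < e" "x ^ e = 1"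
proof -
  have "\<not> inj (\<lambda>k::nat. x ^ k)"
    using finite_imageD [of "\<lambda>k::nat. x ^ k" UNIV] finite_subset [OF subset_UNIV assms(1)] by auto
  then obtain i j where "x ^ i = x ^ j" "i \<noteq> j"
    by (auto simp: inj_def)
  then obtain i j where ij: "x ^ i = x ^ j" "i < j"
    by (metis linorder_neqE_nat)
  have "x ^ (j - i) = x ^ (j - i) * (x * y) ^ i"
    using assms(2) by simp
  also have "\<dots> = x ^ (j - i + i) * y ^ i"
    by (simp only: power_add power_mult_distrib mult.assoc)
  also have "\<dots> = x ^ i * y ^ i"
    using ij by simp
  also have "\<dots> = 1"
    using assms(2) by (simp flip: power_mult_distrib)
  finally show ?thesis
    using that [of "j - i"] ij(2) by simp
qed

text \<open>
  With \<open>N = d v + e uv\<close> one has \<open>N\<^sup>2 = 0\<close>, so the inverse of \<open>c + N\<close> is \<open>c\<^sup>-\<^sup>1 - N c\<^sup>-\<^sup>2\<close>.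
\<close>
lemma ruv_inverse:
  fixes c d e :: "'a::field"
  assumes "c \<noteq> 0"
  shows "(emb c + emb d * rv + emb e * (ru * rv))
    * (emb (inverse c) - (emb d * rv + emb e * (ru * rv)) * emb (inverse c * inverse c)) = 1"
proof -
  have "N * N = 0 \<Longrightarrow> x * i = 1 \<Longrightarrow> (x + N) * (i - N * (i * i)) = 1" for N x i :: "'a ruv"
  proof -
    assume *: "N * N = 0" "x * i = 1"
    have "(x + N) * (i - N * (i * i)) = x * i + N * i * (1 - x * i) - N * N * (i * i)"
      by (simp add: algebra_simps)
    with * show ?thesis by simp
  qed
  moreover have "(emb d * rv + emb e * (ru * rv)) * (emb d * rv + emb e * (ru * rv)) = 0"
    by (simp add: emb_def ru_def rv_def times_ruv_def plus_ruv_def zero_ruv_def)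
  moreover have "emb c * emb (inverse c) = 1"
    using assms by (simp flip: emb_hom)
  ultimately show ?thesis
    unfolding emb_hom(4) add.assoc by blast
qed

lemma field_power_CARD_power:
  fixes x :: "'a::{field,finite}"
  shows "x ^ CARD('a) ^ k = x"
  by (induction k) (simp_all add: field_power_CARD power_mult)

section \<open>The dual code\<close>

theorem theorem4p6:
  fixes p m s q0 r0 n l t \<mu> :: nat
    and \<alpha>0 \<alpha>1 \<alpha>3 \<alpha>4 :: "'a::{field,finite}"
    and \<alpha> \<alpha>inv :: "'a ruv"
    and z :: "'a ruv poly"
    and z0 z1 z2 :: "nat \<Rightarrow> 'a"
    and C AC :: "'a ruv poly set set"
  assumes "prime p" and "p \<noteq> 3" and "m > 0" and "s > 0"
    and "CARD('a) = p ^ m"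
    and "s = q0 * m + r0" and "r0 < m"
    and "\<alpha>0 = \<alpha>1 ^ (p ^ (m - r0))"
    and "n = 3 * p ^ s"
    and "\<alpha>1 \<noteq> 0" and "\<alpha>3 \<noteq> 0" and "\<alpha>4 \<noteq> 0"
    and "\<alpha> = emb \<alpha>1 + emb \<alpha>3 * rv + emb \<alpha>4 * (ru * rv)"
    and "\<nexists>\<beta>. \<beta> ^ 3 = \<alpha>"
    and "\<alpha>inv = inv\<^bsub>ring_of_type_algebra\<^esub> \<alpha>"
    and "l \<le> 2 * p ^ s - 1" and "t < l"
    and "cc_class n \<alpha> z = \<zero>\<^bsub>cc_ring n \<alpha>\<^esub> \<or> cc_class n \<alpha> z \<in> Units (cc_ring n \<alpha>)"
    and "\<mu> < (if cc_class n \<alpha> z = \<zero>\<^bsub>cc_ring n \<alpha>\<^esub> then l else min l (2 * p ^ s + t - l))"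
    and "cc_class n \<alpha> z \<in> Units (cc_ring n \<alpha>) \<Longrightarrow>
           cc_class n \<alpha> z = cc_class n \<alpha>
             (\<Sum>\<kappa><\<mu> - t. [:emb (z2 \<kappa>), emb (z1 \<kappa>), emb (z0 \<kappa>):] * cubic \<alpha>0 ^ \<kappa>)
           \<and> [:z2 0, z1 0, z0 0:] \<noteq> 0"
    and "C = genideal (cc_ring n \<alpha>)
           {cc_class n \<alpha> (cubic \<alpha>0 ^ l + smult ru (cubic \<alpha>0 ^ t * z)),
            cc_class n \<alpha> (smult ru (cubic \<alpha>0 ^ \<mu>))}"
    and "AC = reciprocal_set n \<alpha> \<alpha>inv (annihilator (cc_ring n \<alpha>) C)"
  shows "dual_code n (code_of n \<alpha> C) = code_of n \<alpha>inv AC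
    \<and> (cc_class n \<alpha> z = \<zero>\<^bsub>cc_ring n \<alpha>\<^esub> \<longrightarrow>
        AC = genideal (cc_ring n \<alpha>inv)
          {cc_class n \<alpha>inv
             (smult (emb ((- \<alpha>0) ^ (2 * p ^ s - \<mu>))) (cubic (inverse \<alpha>0) ^ (2 * p ^ s - \<mu>))),
           cc_class n \<alpha>inv (smult ru (cubic (inverse \<alpha>0) ^ (2 * p ^ s - l)))})
    \<and> (cc_class n \<alpha> z \<in> Units (cc_ring n \<alpha>) \<longrightarrow>
        AC = genideal (cc_ring n \<alpha>inv)
          {cc_class n \<alpha>inv
             (smult (emb ((- \<alpha>0) ^ (2 * p ^ s - \<mu>))) (cubic (inverse \<alpha>0) ^ (2 * p ^ s - \<mu>))
              - smult (ru * emb ((- \<alpha>0) ^ (2 * p ^ s + t - l - \<mu>)))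
                  (cubic (inverse \<alpha>0) ^ (2 * p ^ s + t - l - \<mu>)
                   * (\<Sum>\<kappa><\<mu> - t.
                        [:emb (z0 \<kappa>), emb (z1 \<kappa>), emb (z2 \<kappa>):]
                        * smult (emb ((- \<alpha>0) ^ \<kappa>)) (cubic (inverse \<alpha>0) ^ \<kappa>)
                        * Polynomial.monom 1 (3 * l - 3 * t - 3 * \<kappa> - 2)))),
           cc_class n \<alpha>inv (smult ru (cubic (inverse \<alpha>0) ^ (2 * p ^ s - l)))})"
proof -
  define q where "q = p ^ s"
  define w :: "'a poly" where "w = Polynomial.monom 1 3 - [:\<alpha>0:]"
  have q: "0 < q" and n: "n = 3 * q" "0 < n"
    using assms(1,9) by (simp_all add: q_def prime_gt_0_nat)
  have l: "l \<le> 2 * q" and \<mu>l: "\<mu> < l"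
    using assms(16,19) by (auto simp: q_def split: if_splits)
  have \<alpha>0_nonzero: "\<alpha>0 \<noteq> 0"
    using assms(8,10) by simp
  \<comment> \<open>The exponent in the definition of \<open>\<alpha>\<^sub>0\<close> completes \<open>p\<^sup>s\<close> to a power of the field size.\<close>
  have "\<alpha>0 ^ q = \<alpha>1 ^ p ^ (m - r0 + s)"
    by (simp add: assms(8) q_def power_add flip: power_mult)
  also have "m - r0 + s = m * Suc q0"
    using assms(6,7) by simp
  also have "\<alpha>1 ^ p ^ (m * Suc q0) = \<alpha>1 ^ CARD('a) ^ Suc q0"
    by (simp only: assms(5) power_mult)
  also have "\<dots> = \<alpha>1"
    by (rule field_power_CARD_power)
  finally have \<alpha>0_power: "\<alpha>0 ^ q = \<alpha>1" .
  interpret R: uv_chain n q \<alpha>1 \<alpha>3 \<alpha>4 w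
  proof
    show "w \<noteq> 0"
      using coeff_modulus_top(2) [of 3 \<alpha>0] leading_coeff_0_iff [of w] by (simp add: w_def del: leading_coeff_0_iff)
    show "w ^ q = Polynomial.monom 1 n - [:\<alpha>1:]"
      using monom_minus_const_power_char [OF assms(1,5), of 3 \<alpha>0 s]
      by (simp only: w_def q_def [symmetric] \<alpha>0_power n(1))
  qed (rule assms(11))
  have R\<alpha>: "R.\<alpha> = \<alpha>"
    by (simp only: R.\<alpha>_def assms(13))
  obtain \<beta> where \<beta>: "\<alpha> * \<beta> = 1"
    using ruv_inverse [OF assms(10)] unfolding assms(13) by blast
  then have \<alpha>inv: "\<alpha> * \<alpha>inv = 1"
    using inv_ring_of_type_algebra [OF \<beta>] by (simp only: assms(15))
  interpret RP: reciprocal_pair n \<alpha> \<alpha>inv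
    using n \<alpha>inv by unfold_locales
  obtain e where e: "\<alpha> ^ e = 1" "0 < e"
    using unit_finite_order [OF finite_UNIV_ruv \<alpha>inv] by blast
  have cubic_lift: "cubic \<alpha>0 ^ k = lift_poly (w ^ k)" for k
    by (simp only: cubic_eq_lift w_def lift_poly_power)
  let ?f1 = "cubic \<alpha>0 ^ l + smult ru (cubic \<alpha>0 ^ t * z)" and ?f2 = "smult ru (cubic \<alpha>0 ^ \<mu>)"
  have C_carrier: "C \<subseteq> carrier (cc_ring n \<alpha>)"
    by (auto simp: assms(21) genideal_pair)
  have "dual_code n (code_of n \<alpha> C) = code_of n \<alpha>inv AC"
    unfolding assms(22)
    by (rule RP.dual_code_eq [OF e C_carrier]) (unfold assms(21), rule genideal_pair_closed)
  moreover
  have AC_flip: "AC = {cc_class n \<alpha>inv g | g.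
      cc_class n \<alpha> (cc_flip n \<alpha>inv g) \<in> annihilator (cc_ring n \<alpha>) C}"
    unfolding assms(22) by (rule RP.reciprocal_set_eq [OF e annihilator_closed [OF C_carrier]])
  \<comment> \<open>Both cases of the claim, for a correction term \<open>b\<close> that suits \<open>a\<close>: the first generator \<open>G1\<close> is the flip of the first
    generator of the annihilator, cleared of negative powers of \<open>x\<close>.\<close>
  have AC_eq: "AC = genideal (cc_ring n \<alpha>inv) {cc_class n \<alpha>inv G1,
      cc_class n \<alpha>inv (smult ru (cubic (inverse \<alpha>0) ^ (2 * p ^ s - l)))}"
    if f1: "cc_cong n \<alpha> (cubic \<alpha>0 ^ t * z) a"
      and cross: "cubic \<alpha>0 ^ l * b + a * cubic \<alpha>0 ^ (2 * q - \<mu>) = 0"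
      and G1: "cc_cong n \<alpha>inv G1
        (Polynomial.monom 1 (3 * (2 * q - \<mu>)) * cc_flip n \<alpha> (cubic \<alpha>0 ^ (2 * q - \<mu>) + [:ru:] * b))"
    for a b G1
  proof -
    let ?g1 = "cubic \<alpha>0 ^ (2 * q - \<mu>) + [:ru:] * b"
    let ?g2 = "[:ru:] * cubic \<alpha>0 ^ (2 * q - l)"
    have mult_f1: "cc_cong n \<alpha> (f * ?f1) (f * (cubic \<alpha>0 ^ l + [:ru:] * a))" for f
      using cc_cong_smult [OF f1, of ru]
      by (intro cc_cong_mult cc_cong_add cc_cong_refl) simp
    have ann: "cc_class n \<alpha> f \<in> annihilator (cc_ring n \<alpha>) C
        \<longleftrightarrow> (\<exists>c d. cc_cong n \<alpha> f (c * ?g1 + d * ?g2))" for f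
    proof -
      have "cc_class n \<alpha> f \<in> annihilator (cc_ring n \<alpha>) C
          \<longleftrightarrow> cc_cong n \<alpha> (f * ?f1) 0 \<and> cc_cong n \<alpha> (f * ?f2) 0"
        unfolding assms(21) by (rule cc_class_mem_annihilator_genideal_pair)
      also have "\<dots> \<longleftrightarrow> cc_cong n \<alpha> (f * (cubic \<alpha>0 ^ l + [:ru:] * a)) 0
          \<and> cc_cong n \<alpha> (f * ([:ru:] * cubic \<alpha>0 ^ \<mu>)) 0"
        using cc_cong_trans [OF mult_f1 [of f]] cc_cong_trans [OF cc_cong_sym [OF mult_f1 [of f]]]
        by auto
      also have "\<dots> \<longleftrightarrow> (\<exists>c d. cc_cong n \<alpha> f (c * ?g1 + d * ?g2))"
      proof -
        have "cc_cong n R.\<alpha> ([:ru:] * (lift_poly (w ^ l) * b + a * lift_poly (w ^ (2 * q - \<mu>)))) 0"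
          using cross by (simp only: cubic_lift [symmetric] mult_zero_right) simp
        from R.annihilator_generators [OF less_imp_le [OF \<mu>l] l this, of f]
        show ?thesis
          by (simp only: R\<alpha> cubic_lift)
      qed
      finally show ?thesis .
    qed
    have G2: "cc_cong n \<alpha>inv (smult ru (cubic (inverse \<alpha>0) ^ (2 * p ^ s - l)))
        (smult (emb (inverse ((- \<alpha>0) ^ (2 * q - l)))) (Polynomial.monom 1 (3 * (2 * q - l))) * cc_flip n \<alpha> ?g2)"
    proof -
      let ?c = "(- \<alpha>0) ^ (2 * q - l)"
      have "cc_cong n \<alpha>inv
          (smult (ru * emb (inverse ?c)) (smult (emb ?c) (cubic (inverse \<alpha>0) ^ (2 * q - l))))
          (smult (ru * emb (inverse ?c))
            (Polynomial.monom 1 (3 * (2 * q - l)) * cc_flip n \<alpha> (cubic \<alpha>0 ^ (2 * q - l))))"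
        by (intro cc_cong_smult cc_cong_sym
            [OF flip_cubic_power [OF RP.reciprocal_pair_axioms \<alpha>0_nonzero]])
      moreover have "emb (inverse ?c) * emb ?c = 1"
        using \<alpha>0_nonzero by (simp flip: emb_hom)
      then have "ru * emb (inverse ?c) * emb ?c = ru"
        by (simp only: mult.assoc mult_1_right)
      ultimately show ?thesis
        by (simp add: cc_flip_simps q_def [symmetric] mult_ac)
    qed
    interpret S: reciprocal_pair n \<alpha>inv \<alpha> by (rule RP.swap)
    have U1: "cc_cong n \<alpha>inv (Polynomial.monom 1 k * Polynomial.monom \<alpha> (n - 1) ^ k) 1" for k
      by (rule S.X_inverse_power)
    have U2: "cc_cong n \<alpha>inv (smult (emb (inverse c)) (Polynomial.monom 1 k)
        * smult (emb c) (Polynomial.monom \<alpha> (n - 1) ^ k)) 1" if "c \<noteq> 0" for c k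
    proof -
      have "emb (inverse c) * emb c = 1" "emb c * emb (inverse c) = 1"
        using that by (simp_all flip: emb_hom)
      then show ?thesis
        using U1 [of k] by simp
    qed
    have "(- \<alpha>0) ^ (2 * q - l) \<noteq> 0"
      using \<alpha>0_nonzero by simp
    then have "genideal (cc_ring n \<alpha>inv) {cc_class n \<alpha>inv G1,
          cc_class n \<alpha>inv (smult ru (cubic (inverse \<alpha>0) ^ (2 * p ^ s - l)))}
        = {cc_class n \<alpha>inv g | g. \<exists>c d. cc_cong n \<alpha> (cc_flip n \<alpha>inv g) (c * ?g1 + d * ?g2)}"
      by (rule RP.genideal_pair_eq_of_flip [OF G1 U1 G2 U2])
    then show ?thesis
      by (simp only: AC_flip ann)
  qed
  have "AC = genideal (cc_ring n \<alpha>inv)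
      {cc_class n \<alpha>inv
         (smult (emb ((- \<alpha>0) ^ (2 * p ^ s - \<mu>))) (cubic (inverse \<alpha>0) ^ (2 * p ^ s - \<mu>))),
       cc_class n \<alpha>inv (smult ru (cubic (inverse \<alpha>0) ^ (2 * p ^ s - l)))}"
    if "cc_class n \<alpha> z = \<zero>\<^bsub>cc_ring n \<alpha>\<^esub>"
  proof (rule AC_eq)
    have "cc_cong n \<alpha> z 0"
      using that by (simp only: cc_class_ops cc_class_eq_iff)
    from cc_cong_mult [OF cc_cong_refl this, of "cubic \<alpha>0 ^ t"]
    show "cc_cong n \<alpha> (cubic \<alpha>0 ^ t * z) 0"
      by simp
    show "cubic \<alpha>0 ^ l * 0 + 0 * cubic \<alpha>0 ^ (2 * q - \<mu>) = 0"
      by simp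
    show "cc_cong n \<alpha>inv
        (smult (emb ((- \<alpha>0) ^ (2 * p ^ s - \<mu>))) (cubic (inverse \<alpha>0) ^ (2 * p ^ s - \<mu>)))
        (Polynomial.monom 1 (3 * (2 * q - \<mu>)) * cc_flip n \<alpha> (cubic \<alpha>0 ^ (2 * q - \<mu>) + [:ru:] * 0))"
      using cc_cong_sym [OF flip_cubic_power [OF RP.reciprocal_pair_axioms \<alpha>0_nonzero]]
      by (simp add: q_def)
  qed
  moreover
  have "AC = genideal (cc_ring n \<alpha>inv)
      {cc_class n \<alpha>inv
         (smult (emb ((- \<alpha>0) ^ (2 * p ^ s - \<mu>))) (cubic (inverse \<alpha>0) ^ (2 * p ^ s - \<mu>))
          - smult (ru * emb ((- \<alpha>0) ^ (2 * p ^ s + t - l - \<mu>)))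
              (cubic (inverse \<alpha>0) ^ (2 * p ^ s + t - l - \<mu>)
               * (\<Sum>\<kappa><\<mu> - t.
                    [:emb (z0 \<kappa>), emb (z1 \<kappa>), emb (z2 \<kappa>):]
                    * smult (emb ((- \<alpha>0) ^ \<kappa>)) (cubic (inverse \<alpha>0) ^ \<kappa>)
                    * Polynomial.monom 1 (3 * l - 3 * t - 3 * \<kappa> - 2)))),
       cc_class n \<alpha>inv (smult ru (cubic (inverse \<alpha>0) ^ (2 * p ^ s - l)))}"
    (is "_ = genideal _ {cc_class _ _ (?A - smult (ru * emb ?c) (?B * ?S)), _}")
    if unit: "cc_class n \<alpha> z \<in> Units (cc_ring n \<alpha>)"
  proof (rule AC_eq)
    define j where "j = 2 * q + t - l - \<mu>"
    \<comment> \<open>A unit of the nontrivial factor ring is not zero, so the bound on \<open>\<mu>\<close> is the one that keeps the exponent \<open>j\<close> from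
      being truncated.\<close>
    have "cc_class n \<alpha> z \<noteq> \<zero>\<^bsub>cc_ring n \<alpha>\<^esub>"
    proof
      assume zero: "cc_class n \<alpha> z = \<zero>\<^bsub>cc_ring n \<alpha>\<^esub>"
      interpret Q: cring "cc_ring n \<alpha>" by (rule cring_cc_ring)
      have "\<one>\<^bsub>cc_ring n \<alpha>\<^esub> = \<zero>\<^bsub>cc_ring n \<alpha>\<^esub>"
        using Q.Units_r_inv_ex [OF unit] zero by auto
      then have "cc_cong n \<alpha> 1 0"
        by (simp only: cc_class_ops cc_class_eq_iff)
      then have "(1 :: 'a ruv poly) = 0"
        by (rule cc_cong_unique) (use n in simp_all)
      then show False by simp
    qed
    then have "\<mu> < 2 * q + t - l"
      using assms(19) by (simp add: q_def)
    then have j: "l + j = t + (2 * q - \<mu>)" "2 * q - \<mu> = j + (l - t)"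
      using assms(17) l by (simp_all add: j_def)
    let ?z = "\<Sum>\<kappa><\<mu> - t. [:emb (z2 \<kappa>), emb (z1 \<kappa>), emb (z0 \<kappa>):] * cubic \<alpha>0 ^ \<kappa>"
    have "cc_cong n \<alpha> z ?z"
      using assms(20) [OF unit] by (simp only: cc_class_eq_iff)
    then show "cc_cong n \<alpha> (cubic \<alpha>0 ^ t * z) (cubic \<alpha>0 ^ t * ?z)"
      by (intro cc_cong_mult cc_cong_refl)
    have "cubic \<alpha>0 ^ l * (cubic \<alpha>0 ^ j * ?z) = cubic \<alpha>0 ^ t * ?z * cubic \<alpha>0 ^ (2 * q - \<mu>)"
    proof -
      have "cubic \<alpha>0 ^ l * (cubic \<alpha>0 ^ j * ?z) = cubic \<alpha>0 ^ (l + j) * ?z"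
        by (simp only: power_add mult.assoc)
      also have "\<dots> = cubic \<alpha>0 ^ t * ?z * cubic \<alpha>0 ^ (2 * q - \<mu>)"
        unfolding j(1) power_add by (simp only: mult_ac)
      finally show ?thesis .
    qed
    then show "cubic \<alpha>0 ^ l * (- (cubic \<alpha>0 ^ j * ?z)) + cubic \<alpha>0 ^ t * ?z * cubic \<alpha>0 ^ (2 * q - \<mu>) = 0"
      by simp
    let ?x = "\<lambda>k. Polynomial.monom (1 :: 'a ruv) k"
    note flip_cubic = flip_cubic_power [OF RP.reciprocal_pair_axioms \<alpha>0_nonzero]
    have "cc_cong n \<alpha>inv
        (?x (3 * (2 * q - \<mu>)) * cc_flip n \<alpha> (cubic \<alpha>0 ^ (2 * q - \<mu>))
          - [:ru:] * ((?x (3 * j) * cc_flip n \<alpha> (cubic \<alpha>0 ^ j)) * (?x (3 * l - 3 * t) * cc_flip n \<alpha> ?z)))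
        (?A - [:ru:] * (smult (emb ?c) ?B * ?S))"
      unfolding q_def [symmetric] j_def [symmetric]
    proof (intro cc_cong_diff cc_cong_mult cc_cong_refl flip_cubic)
      show "cc_cong n \<alpha>inv (?x (3 * l - 3 * t) * cc_flip n \<alpha> ?z) ?S"
        by (rule flip_quadratic_cubic_sum [OF RP.reciprocal_pair_axioms \<alpha>0_nonzero])
          (use \<mu>l in simp)
    qed
    \<comment> \<open>The power of \<open>x\<close> that clears \<open>w\<^sup>2\<^sup>q\<^sup>-\<^sup>\<mu>\<close> splits into the one for \<open>w\<^sup>j\<close> and \<open>x\<^sup>3\<^sup>l\<^sup>-\<^sup>3\<^sup>t\<close>, which is left for the sum.\<close>
    moreover have "?x (3 * (2 * q - \<mu>)) = ?x (3 * j) * ?x (3 * l - 3 * t)"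
      unfolding j(2) by (simp add: mult_monom diff_mult_distrib2 distrib_left)
    then have "?x (3 * (2 * q - \<mu>)) * cc_flip n \<alpha> (cubic \<alpha>0 ^ (2 * q - \<mu>) + [:ru:] * (- (cubic \<alpha>0 ^ j * ?z)))
        = ?x (3 * (2 * q - \<mu>)) * cc_flip n \<alpha> (cubic \<alpha>0 ^ (2 * q - \<mu>))
          - [:ru:] * ((?x (3 * j) * cc_flip n \<alpha> (cubic \<alpha>0 ^ j)) * (?x (3 * l - 3 * t) * cc_flip n \<alpha> ?z))"
      by (simp only: mult_minus_right add_uminus_conv_diff cc_flip_simps right_diff_distrib mult_ac)
    moreover have "[:ru:] * (smult c f * g) = smult (ru * c) (f * g)" for c and f g :: "'a ruv poly"
      by (simp add: mult.commute [of ru c])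
    ultimately show "cc_cong n \<alpha>inv (?A - smult (ru * emb ?c) (?B * ?S))
        (?x (3 * (2 * q - \<mu>)) * cc_flip n \<alpha> (cubic \<alpha>0 ^ (2 * q - \<mu>) + [:ru:] * (- (cubic \<alpha>0 ^ j * ?z))))"
      by (simp only: cc_cong_sym)
  qed
  ultimately show ?thesis
    by blast
qed

end
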